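(* Let $h^{\rm c}:[1,2]\to[1,\infty]$ and $h:[1,3]\to[1,\infty]$ be nonincreasing functions with $h(\kappa)\ge h^{\rm c}(\kappa)$ for all $\kappa\in[1,2]$ and $h^{\rm c}(2)=h(3)=1$. Then there exists a metric measure space $\mathfrak Z$ such that for each $\kappa\in[1,2)$ the operator $\mathcal M^{\rm c}_{\kappa,\mathfrak Z}$ is of weak type $(p,p)$ if and only if $p>h^{\rm c}(\kappa)$ or $p=\infty$, and for each $\kappa\in[1,3)$ the operator $\mathcal M_{\kappa,\mathfrak Z}$ is of weak type $(p,p)$ if and only if $p>h(\kappa)$ or $p=\infty$.
   Context: Metric measure space $(X,\rho,\mu)$: nonempty set, metric, nonnegative Borel measure, every open ball $B(x,s)$ having finite strictly positive measure. For $\kappa\ge1$: $\mathcal M^{\rm c}_{\kappa}f(x)=\sup_{s>0}\mu(B(x,\kappa s))^{-1}\int_{B(x,s)}|f|d\mu$ and $\mathcal M_\kappa f(x)=\sup\{\mu(B(y,\kappa s))^{-1}\int_{B(y,s)}|f|d\mu: y\in X, s>0, x\in B(y,s)\}$. Weak type $(p,p)$ for $p\in[1,\infty)$: $\lambda\mu(\{|Tf|>\lambda\})^{1/p}\lesssim\|f\|_p$ uniformly in $f\in L^p$, $\lambda>0$; weak type $(\infty,\infty)$ means boundedness on $L^\infty$. *)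

theory Defs
  imports "HOL-Probability.Probability"
begin

definition mms :: "'a set \<Rightarrow> ('a \<Rightarrow> 'a \<Rightarrow> real) \<Rightarrow> 'a measure \<Rightarrow> bool" where
  "mms X \<rho> \<mu> \<longleftrightarrow> X \<noteq> {} \<and> Metric_space X \<rho> \<and> space \<mu> = X \<and>
     sets \<mu> = sigma_sets X {U. openin (Metric_space.mtopology X \<rho>) U} \<and>
     (\<forall>x\<in>X. \<forall>s>0. 0 < emeasure \<mu> (Metric_space.mball X \<rho> x s) \<and>
                    emeasure \<mu> (Metric_space.mball X \<rho> x s) < \<infinity>)"

definition cmax :: "'a set \<Rightarrow> ('a \<Rightarrow> 'a \<Rightarrow> real) \<Rightarrow> 'a measure \<Rightarrow> real \<Rightarrow> ('a \<Rightarrow> real) \<Rightarrow> 'a \<Rightarrow> ennreal" where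
  "cmax X \<rho> \<mu> \<kappa> f x = (SUP s\<in>{0<..}.
      (\<integral>\<^sup>+ y\<in>Metric_space.mball X \<rho> x s. ennreal \<bar>f y\<bar> \<partial>\<mu>) / emeasure \<mu> (Metric_space.mball X \<rho> x (\<kappa> * s)))"

definition ncmax :: "'a set \<Rightarrow> ('a \<Rightarrow> 'a \<Rightarrow> real) \<Rightarrow> 'a measure \<Rightarrow> real \<Rightarrow> ('a \<Rightarrow> real) \<Rightarrow> 'a \<Rightarrow> ennreal" where
  "ncmax X \<rho> \<mu> \<kappa> f x = (SUP (y, s)\<in>{(y, s). y \<in> X \<and> s > 0 \<and> x \<in> Metric_space.mball X \<rho> y s}.
      (\<integral>\<^sup>+ z\<in>Metric_space.mball X \<rho> y s. ennreal \<bar>f z\<bar> \<partial>\<mu>) / emeasure \<mu> (Metric_space.mball X \<rho> y (\<kappa> * s)))"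

text \<open>Outer measure induced by \<mu> (level sets of maximal functions need not be measurable).\<close>
definition outer_meas :: "'a measure \<Rightarrow> 'a set \<Rightarrow> ennreal" where
  "outer_meas \<mu> S = (INF A\<in>{A \<in> sets \<mu>. S \<subseteq> A}. emeasure \<mu> A)"

text \<open>Weak type (p,p) for p \<in> [1,\<infinity>) (p = \<infinity>: boundedness on L^\<infinity>).
  For finite p, \<lambda> \<mu>{|Tf|>\<lambda>}^{1/p} \<le> C \<parallel>f\<parallel>_p is written raised to the p-th power.\<close>
definition weak_type :: "'a set \<Rightarrow> 'a measure \<Rightarrow> (('a \<Rightarrow> real) \<Rightarrow> 'a \<Rightarrow> ennreal) \<Rightarrow> ereal \<Rightarrow> bool" where
  "weak_type X \<mu> T p \<longleftrightarrow>
    (if p = \<infinity> then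
       (\<exists>C::real. C \<ge> 0 \<and> (\<forall>f. f \<in> borel_measurable \<mu> \<and> esssup \<mu> (\<lambda>x. ennreal \<bar>f x\<bar>) < \<infinity> \<longrightarrow>
           outer_meas \<mu> {x \<in> X. T f x > ennreal C * esssup \<mu> (\<lambda>x. ennreal \<bar>f x\<bar>)} = 0))
     else
       (\<exists>C::real. C \<ge> 0 \<and> (\<forall>f. f \<in> borel_measurable \<mu> \<and>
            (\<integral>\<^sup>+ x. ennreal (\<bar>f x\<bar> powr real_of_ereal p) \<partial>\<mu>) < \<infinity> \<longrightarrow>
           (\<forall>t::real. t > 0 \<longrightarrow>
              ennreal (t powr real_of_ereal p) * outer_meas \<mu> {x \<in> X. T f x > ennreal t}
                \<le> ennreal (C powr real_of_ereal p) * (\<integral>\<^sup>+ x. ennreal (\<bar>f x\<bar> powr real_of_ereal p) \<partial>\<mu>)))))"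

end

theory Submission
  imports Defs
begin

text \<open>
  The space is a disjoint union of finite components at mutual distance \<open>4\<close>, weighted so that the total
  mass is finite. A component has a hub of relative mass \<open>w\<close> and \<open>N\<close> leaves of relative mass \<open>1\<close>.
  If each leaf is covered by a ball that contains the hub and whose \<open>\<kappa>\<close>-dilation misses the other
  leaves, then testing on the hub shows that the weak type \<open>(p, p)\<close> constant, to the power \<open>p\<close>, is
  comparable to \<open>N * w powr (p - 1)\<close>; if there are no such balls, then the constant is bounded uniformly
  in \<open>N\<close> and \<open>w\<close>. In a star, leaves have distance \<open>1\<close> from the hub and \<open>D \<le> 2\<close> from each other, and
  the balls exist, with leaves as centres, iff \<open>\<kappa> < D\<close>. In a fork, intermediate points of tiny mass
  serve as centres: they exist iff \<open>\<kappa> < D \<le> 3\<close>, and there are no bad balls centred at leaves. So stars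
  realise the prescribed function for the centred operator and forks the one for the noncentred
  operator; stars do not harm the latter because \<open>h \<ge> hc\<close>.
\<close>

section \<open>Countable families of thresholds\<close>

text \<open>An element of \<open>A\<close> with a smaller one below it has a rational in between,
  and \<open>c\<close> picks a member of \<open>A\<close> below that rational. A least element has
  no such rational and is added separately.\<close>

lemma countable_coinitial:
  fixes A :: "real set"
  shows "\<exists>B\<subseteq>A. countable B \<and> (\<forall>a\<in>A. \<exists>b\<in>B. b \<le> a)"
proof -
  define c where "c q = (SOME a. a \<in> A \<and> a \<le> q)" for q :: real
  have c: "c q \<in> A \<and> c q \<le> q" if "\<exists>a\<in>A. a \<le> q" for q
    unfolding c_def using someI_ex[of "\<lambda>a. a \<in> A \<and> a \<le> q"] that by blast
  define B where "B = c ` {q\<in>\<rat>. \<exists>a\<in>A. a \<le> q} \<union> {a\<in>A. \<forall>b\<in>A. a \<le> b}"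
  have "countable {q\<in>\<rat>. \<exists>a\<in>A. a \<le> q}"
    by (rule countable_subset[OF _ countable_rat]) auto
  moreover have "finite {a\<in>A. \<forall>b\<in>A. a \<le> b}"
  proof (cases "\<exists>a. a \<in> A \<and> (\<forall>b\<in>A. a \<le> b)")
    case True
    then obtain a where "a \<in> A" "\<forall>b\<in>A. a \<le> b" by blast
    then have "{a\<in>A. \<forall>b\<in>A. a \<le> b} \<subseteq> {a}" by force
    then show ?thesis using finite_subset by blast
  next
    case False
    then have "{a\<in>A. \<forall>b\<in>A. a \<le> b} = {}" by blast
    then show ?thesis by (simp only: finite.emptyI)
  qed
  ultimately have "countable B" by (simp add: B_def countable_finite)
  moreover have "B \<subseteq> A" using c by (auto simp: B_def)
  moreover have "\<exists>b\<in>B. b \<le> a" if "a \<in> A" for a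
  proof (cases "\<forall>b\<in>A. a \<le> b")
    case True
    then have "a \<in> B" using that by (simp add: B_def)
    then show ?thesis by blast
  next
    case False
    then obtain a' where a': "a' \<in> A" "a' < a" by force
    then obtain q where q: "q \<in> \<rat>" "a' < q" "q < a" using Rats_dense_in_real by blast
    then have "\<exists>a\<in>A. a \<le> q" using a' by (meson less_imp_le)
    then have "c q \<in> B" "c q \<le> q" using c q by (auto simp: B_def)
    then show ?thesis using q by (meson less_imp_le order_trans)
  qed
  ultimately show ?thesis by blast
qed

text \<open>Absorbs the factor \<open>k\<close> in \<open>k * exp (k * (r n - p))\<close> uniformly
  in \<open>k\<close>, as long as \<open>r n\<close> stays below \<open>p\<close>.\<close>

lemma mult_exp_neg_le:
  fixes x d :: real
  assumes "0 < d"
  shows "x * exp (- (x * d)) \<le> 1 / d"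
proof -
  have "x * d \<le> exp (x * d)" using exp_ge_add_one_self[of "x * d"] by linarith
  then show ?thesis using assms by (simp add: exp_minus field_simps)
qed

text \<open>
  Enumerate the rationals as \<open>r n\<close> and let \<open>S n = {x. r n \<le> H x}\<close>. For each pair \<open>(n, k)\<close>
  take \<open>w = exp (- k)\<close> and \<open>N \<approx> k * exp (k * (r n - 1))\<close>, so that \<open>N * w powr (p - 1) \<approx> k * exp (k * (r n - p))\<close>.
  Ideally \<open>\<kappa> < D\<close> would mean \<open>\<kappa> \<in> S n\<close>, which is impossible when \<open>S n\<close> is closed. Instead \<open>D\<close> is the
  least of the first \<open>n + k\<close> members of a countable set of test points that lie outside \<open>S n\<close>; then
  for fixed \<open>\<kappa>\<close> and \<open>p > H \<kappa>\<close> only finitely many pairs are spurious.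
\<close>

lemma threshold_profile:
  fixes H :: "real \<Rightarrow> ereal"
  assumes b: "1 < b"
    and mono: "\<And>x y. \<lbrakk>1 \<le> x; x \<le> y; y \<le> b\<rbrakk> \<Longrightarrow> H y \<le> H x"
  shows "\<exists>D (N :: nat \<Rightarrow> nat) w. (\<forall>j. 1 \<le> D j \<and> D j \<le> b \<and> 1 \<le> N j \<and> 0 < w j \<and> w j \<le> 1) \<and>
    (\<forall>\<kappa>\<in>{1..<b}. \<forall>p\<ge>1. (\<exists>K. \<forall>j. \<kappa> < D j \<longrightarrow> real (N j) * w j powr (p - 1) \<le> K) \<longleftrightarrow> H \<kappa> < ereal p)"
proof -
  define r where "r n = real_of_rat (from_nat n)" for n :: nat
  have r_surj: "\<exists>n. r n = q" if "q \<in> \<rat>" for q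
    using that by (metis Rats_cases from_nat_to_nat r_def)
  define S where "S n = {x\<in>{1..b}. ereal (r n) \<le> H x}" for n
  obtain B where B: "\<And>n. B n \<subseteq> {1..<b} - S n" "\<And>n. countable (B n)"
      "\<And>n a. a \<in> {1..<b} - S n \<Longrightarrow> \<exists>b\<in>B n. b \<le> a"
    using countable_coinitial[of "{1..<b} - S n" for n] by metis
  \<comment> \<open>The point 1 keeps \<open>T\<close> nonempty, so \<open>from_nat_into\<close>
    enumerates it even if every \<open>B n\<close> is empty.\<close>
  define T where "T = insert 1 (\<Union>n. B n)"
  have T: "countable T" "T \<noteq> {}" "T \<subseteq> {1..<b}" using B b by (auto simp: T_def)
  define t where "t = from_nat_into T"
  have t: "t i \<in> {1..<b}" for i using T by (metis from_nat_into in_mono t_def)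
  \<comment> \<open>Including \<open>b\<close> makes the minimum exist; as
    \<open>\<kappa> < b\<close>, the value \<open>b\<close> alone excludes no
    \<open>\<kappa>\<close>.\<close>
  define U where "U n k = insert b (t ` {i. i \<le> n + k \<and> t i \<notin> S n})" for n k :: nat
  have U_fin: "finite (U n k)" for n k by (simp add: U_def)
  define D where "D j = (case prod_decode j of (n, k) \<Rightarrow> Min (U n k))" for j
  \<comment> \<open>The factor \<open>k\<close> produces failure at the endpoint
    \<open>p = H \<kappa>\<close>: with \<open>r n\<close> at most \<open>1 / k\<close> below
    \<open>p\<close>, the exponential in \<open>k * exp (k * (r n - p))\<close> is at least
    \<open>exp (- 1)\<close>. \<open>Suc\<close> guarantees \<open>1 \<le> N j\<close>.\<close>
  define N where "N j = (case prod_decode j of (n, k) \<Rightarrow> Suc (nat \<lceil>real k * exp (real k * (r n - 1))\<rceil>))" for j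
  define w where "w j = (case prod_decode j of (n, k) \<Rightarrow> exp (- real k))" for j
  have D_eq: "D (prod_encode (n, k)) = Min (U n k)" for n k by (simp add: D_def)
  define F where "F j p = real (N j) * w j powr (p - 1)" for j p
  have F_lower: "real k * exp (real k * (r n - p)) \<le> F (prod_encode (n, k)) p" for n k p
  proof -
    have "real k * exp (real k * (r n - p)) = (real k * exp (real k * (r n - 1))) * exp (- (real k * (p - 1)))"
      by (simp add: mult.assoc exp_add[symmetric] algebra_simps)
    also have "\<dots> \<le> real (N (prod_encode (n, k))) * exp (- (real k * (p - 1)))"
      by (intro mult_right_mono) (auto simp: N_def, linarith)
    also have "\<dots> = F (prod_encode (n, k)) p" by (simp add: F_def w_def powr_def algebra_simps)
    finally show ?thesis .
  qed
  \<comment> \<open>The 2 accounts for \<open>Suc\<close> and for rounding up; it does not grow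
    because \<open>w j \<le> 1 \<le> p\<close>.\<close>
  have F_upper: "F (prod_encode (n, k)) p \<le> 2 + real k * exp (real k * (r n - p))" if "1 \<le> p" for n k p
  proof -
    have "F (prod_encode (n, k)) p = real (N (prod_encode (n, k))) * exp (- (real k * (p - 1)))"
      by (simp add: F_def w_def powr_def algebra_simps)
    also have "real (N (prod_encode (n, k))) \<le> 2 + real k * exp (real k * (r n - 1))"
    proof -
      have "0 \<le> real k * exp (real k * (r n - 1))" by simp
      then have "0 \<le> \<lceil>real k * exp (real k * (r n - 1))\<rceil>" by linarith
      then show ?thesis by (simp add: N_def) linarith
    qed
    also have "(2 + real k * exp (real k * (r n - 1))) * exp (- (real k * (p - 1)))
        = 2 * exp (- (real k * (p - 1))) + real k * exp (real k * (r n - p))"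
      by (simp add: mult.assoc exp_add[symmetric] algebra_simps)
    also have "\<dots> \<le> 2 + real k * exp (real k * (r n - p))"
      using that by simp
    finally show ?thesis by simp
  qed
  have "(\<exists>K. \<forall>j. \<kappa> < D j \<longrightarrow> F j p \<le> K) \<longleftrightarrow> H \<kappa> < ereal p" if \<kappa>: "\<kappa> \<in> {1..<b}" and p: "1 \<le> p" for \<kappa> p
  proof
    assume "H \<kappa> < ereal p"
    then obtain q' :: rat where q': "H \<kappa> < ereal (real_of_rat q')" "real_of_rat q' < p"
      using ereal_dense3 by force
    then obtain m where m: "H \<kappa> < ereal (r m)" "r m < p"
      using r_surj[of "real_of_rat q'"] by (metis Rats_of_rat)
    then have mem: "\<kappa> \<in> {1..<b} - S m" using \<kappa> by (auto simp: S_def)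
    then obtain i where i: "t i \<le> \<kappa>" "t i \<notin> S m"
    proof -
      obtain a where a: "a \<in> B m" "a \<le> \<kappa>" using B(3)[OF mem] by blast
      then have "a \<in> T" by (auto simp: T_def)
      then obtain i where "t i = a" unfolding t_def using T from_nat_into_surj by metis
      then show ?thesis using that a B(1) by blast
    qed
    \<comment> \<open>Spurious pairs satisfy \<open>n + k < i\<close>, so they all lie in this
      finite set and the sum of their values bounds each of them.\<close>
    let ?I = "prod_encode ` ({..i} \<times> {..i})"
    let ?K = "2 + 1 / (p - r m) + (\<Sum>j\<in>?I. F j p)"
    have F_nonneg: "0 \<le> F j p" for j by (simp add: F_def)
    have "F j p \<le> ?K" if "\<kappa> < D j" for j
    proof -
      obtain n k where j: "j = prod_encode (n, k)" by (metis prod_decode_inverse surj_pair)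
      show ?thesis
      proof (cases "r n \<le> r m")
        case True
        have "F j p \<le> 2 + real k * exp (real k * (r n - p))" unfolding j by (rule F_upper[OF p])
        also have "\<dots> \<le> 2 + real k * exp (- (real k * (p - r m)))"
          using True by (auto intro!: mult_left_mono simp: algebra_simps)
        also have "\<dots> \<le> 2 + 1 / (p - r m)" using m mult_exp_neg_le by simp
        also have "\<dots> \<le> ?K" using F_nonneg by (simp add: sum_nonneg)
        finally show ?thesis .
      next
        case False
        \<comment> \<open>Since \<open>S n \<subseteq> S m\<close>, the test point
          \<open>t i \<le> \<kappa>\<close> lies outside \<open>S n\<close>; for
          \<open>i \<le> n + k\<close> it would enter the minimum and give
          \<open>D j \<le> \<kappa>\<close>.\<close>
        then have "ereal (r m) \<le> ereal (r n)" by simp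
        then have "t i \<notin> S n" using i(2) order_trans[of "ereal (r m)" "ereal (r n)" "H (t i)"]
          unfolding S_def by blast
        then have "\<not> i \<le> n + k"
          using that i U_fin[of n k] by (auto simp: j D_eq U_def)
        then have "j \<in> ?I" by (auto simp: j)
        then have "F j p \<le> (\<Sum>j\<in>?I. F j p)" using F_nonneg by (intro member_le_sum) auto
        moreover have "0 \<le> 1 / (p - r m)" using m by simp
        ultimately show ?thesis by linarith
      qed
    qed
    then show "\<exists>K. \<forall>j. \<kappa> < D j \<longrightarrow> F j p \<le> K" by blast
  next
    assume "\<exists>K. \<forall>j. \<kappa> < D j \<longrightarrow> F j p \<le> K"
    then obtain K where K: "\<And>j. \<kappa> < D j \<Longrightarrow> F j p \<le> K" by blast
    show "H \<kappa> < ereal p"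
    proof (rule ccontr)
      assume "\<not> H \<kappa> < ereal p"
      then have Hp: "ereal p \<le> H \<kappa>" by simp
      obtain k' :: nat where "K * exp 1 < real k'" using reals_Archimedean2 by blast
      then obtain k :: nat where k: "K * exp 1 < real k" "1 \<le> k"
        by (intro that[of "Suc k'"]) auto
      \<comment> \<open>A rational this close below \<open>p\<close> gives
        \<open>\<kappa> \<in> S n\<close>, as \<open>r n < p \<le> H \<kappa>\<close>, and keeps the
        exponent \<open>k * (r n - p)\<close> above -1; the value is then at least
        \<open>k * exp (- 1)\<close>, which exceeds \<open>K\<close>.\<close>
      obtain q where q: "q \<in> \<rat>" "p - 1 / real k < q" "q < p"
        using Rats_dense_in_real[of "p - 1 / real k" p] k by auto
      obtain n where n: "r n = q" using r_surj q by blast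
      have "\<kappa> \<in> S n" using \<kappa> q n Hp by (auto simp: S_def intro: order_trans[OF _ Hp])
      \<comment> \<open>\<open>S n\<close> is an initial segment of \<open>{1..b}\<close> because
        \<open>H\<close> is nonincreasing, so test points outside it lie to the right of
        \<open>\<kappa>\<close>.\<close>
      have "\<kappa> < y" if "y \<in> U n k" for y
      proof (cases "y = b")
        case False
        then have y: "y \<notin> S n" "y \<in> {1..<b}" using that t by (auto simp: U_def)
        show ?thesis
        proof (rule ccontr)
          assume "\<not> \<kappa> < y"
          then have "H \<kappa> \<le> H y" using \<kappa> y by (intro mono) auto
          then show False using y \<open>\<kappa> \<in> S n\<close> by (auto simp: S_def)
        qed
      qed (use \<kappa> in auto)
      then have "\<kappa> < D (prod_encode (n, k))"
        using U_fin by (simp add: D_eq U_def)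
      then have "real k * exp (real k * (r n - p)) \<le> K" using K F_lower order_trans by blast
      moreover have "- 1 \<le> real k * (r n - p)"
        using q k n by (simp add: field_simps)
      ultimately have "real k * exp (- 1) \<le> K"
        by (meson exp_le_cancel_iff mult_left_mono of_nat_0_le_iff order_trans)
      then show False using k by (simp add: exp_minus field_simps)
    qed
  qed
  moreover have "1 \<le> D j \<and> D j \<le> b \<and> 1 \<le> N j \<and> 0 < w j \<and> w j \<le> 1" for j
  proof -
    obtain n k where j: "j = prod_encode (n, k)" by (metis prod_decode_inverse surj_pair)
    have "Min (U n k) \<in> U n k" by (rule Min_in[OF U_fin]) (simp add: U_def)
    moreover have "1 \<le> t i \<and> t i \<le> b" for i using t[of i] by auto
    then have "U n k \<subseteq> {1..b}" using b by (auto simp: U_def)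
    ultimately show ?thesis by (auto simp: j D_eq N_def w_def)
  qed
  ultimately show ?thesis unfolding F_def by blast
qed

section \<open>Truncation estimates for integrals of \<open>p\<close>-th powers\<close>

text \<open>Where \<open>a\<close> exceeds the level \<open>u\<close>, the factor
  \<open>(a / u) powr (p - 1)\<close> is at least 1.\<close>

lemma le_threshold_plus_powr:
  fixes a u p :: real
  assumes "0 \<le> a" "0 < u" "1 \<le> p"
  shows "a \<le> u + u powr (1 - p) * a powr p"
proof (cases "a \<le> u")
  case False
  then have "a = a powr (1 - p) * a powr p" using assms by (simp add: powr_add[symmetric])
  also have "\<dots> \<le> u powr (1 - p) * a powr p"
    using False assms by (intro mult_right_mono powr_mono2') auto
  finally show ?thesis using assms by linarith
next
  case True
  have "0 \<le> u powr (1 - p) * a powr p" by simp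
  then show ?thesis using True by linarith
qed

text \<open>Truncation of \<open>|f|\<close> at a level \<open>u\<close> takes the place of
  Hoelder's inequality. The gain \<open>\<theta> powr (p - 1)\<close> for sets much smaller than
  \<open>m\<close> is the source of \<open>w powr (p - 1)\<close> later.\<close>

lemma powr_integral_lower_bound:
  fixes f :: "'a \<Rightarrow> real"
  assumes f: "f \<in> borel_measurable M" and B: "B \<in> sets M"
    and "1 \<le> p" "0 < t" "0 < \<theta>" "0 \<le> m"
    and MB: "emeasure M B \<le> ennreal (\<theta> * m)"
    and large: "ennreal (t * m) \<le> (\<integral>\<^sup>+x\<in>B. ennreal \<bar>f x\<bar> \<partial>M)"
  shows "ennreal ((t / 2) powr p * m) \<le> ennreal (\<theta> powr (p - 1)) * (\<integral>\<^sup>+x\<in>B. ennreal (\<bar>f x\<bar> powr p) \<partial>M)"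
proof -
  \<comment> \<open>At this level the truncated part contributes at most
    \<open>u * \<theta> * m = t / 2 * m\<close>, half of the assumed integral.\<close>
  define u where "u = t / (2 * \<theta>)"
  have u: "0 < u" "u * \<theta> = t / 2" using assms by (auto simp: u_def)
  define V where "V = (\<integral>\<^sup>+x\<in>B. ennreal (\<bar>f x\<bar> powr p) \<partial>M)"
  show ?thesis
  proof (cases "V = \<infinity>")
    case True
    then show ?thesis using assms by (simp add: V_def[symmetric] ennreal_mult_top)
  next
    case False
    then obtain v where v: "0 \<le> v" "V = ennreal v" by (metis ennreal_cases infinity_ennreal_def)
    have "(\<integral>\<^sup>+x\<in>B. ennreal \<bar>f x\<bar> \<partial>M)
        \<le> (\<integral>\<^sup>+x. ennreal u * indicator B x + ennreal (u powr (1 - p)) * (ennreal (\<bar>f x\<bar> powr p) * indicator B x) \<partial>M)"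
    proof (rule nn_integral_mono)
      fix x
      have "ennreal \<bar>f x\<bar> \<le> ennreal (u + u powr (1 - p) * \<bar>f x\<bar> powr p)"
        using u assms by (intro ennreal_leI le_threshold_plus_powr) auto
      also have "\<dots> = ennreal u + ennreal (u powr (1 - p)) * ennreal (\<bar>f x\<bar> powr p)"
        using u by (simp add: ennreal_mult)
      finally show "ennreal \<bar>f x\<bar> * indicator B x
        \<le> ennreal u * indicator B x + ennreal (u powr (1 - p)) * (ennreal (\<bar>f x\<bar> powr p) * indicator B x)"
        by (simp split: split_indicator)
    qed
    also have "\<dots> = ennreal u * emeasure M B + ennreal (u powr (1 - p)) * V"
      using f B by (simp add: nn_integral_add nn_integral_cmult V_def)
    also have "\<dots> \<le> ennreal u * ennreal (\<theta> * m) + ennreal (u powr (1 - p)) * ennreal v"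
      using MB v by (intro add_mono mult_left_mono) auto
    also have "\<dots> = ennreal (t / 2 * m + u powr (1 - p) * v)"
      using u v assms by (simp add: ennreal_mult[symmetric] ennreal_plus[symmetric] mult.assoc[symmetric] del: ennreal_plus)
    finally have "ennreal (t * m) \<le> ennreal (t / 2 * m + u powr (1 - p) * v)"
      using large by (meson order_trans)
    then have "t * m \<le> t / 2 * m + u powr (1 - p) * v"
      using v assms by (subst (asm) ennreal_le_iff) auto
    then have "t / 2 * m \<le> u powr (1 - p) * v" by simp
    then have "u powr (p - 1) * (t / 2 * m) \<le> u powr (p - 1) * (u powr (1 - p) * v)"
      by (rule mult_left_mono) simp
    also have "\<dots> = v" using u by (simp add: mult.assoc[symmetric] powr_add[symmetric])
    finally have "\<theta> powr (p - 1) * (u powr (p - 1) * (t / 2 * m)) \<le> \<theta> powr (p - 1) * v"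
      by (rule mult_left_mono) simp
    moreover have "\<theta> powr (p - 1) * (u powr (p - 1) * (t / 2 * m)) = (t / 2) powr p * m"
    proof -
      have "\<theta> powr (p - 1) * u powr (p - 1) = (t / 2) powr (p - 1)"
        using u assms by (metis powr_mult less_imp_le mult.commute)
      moreover have "(t / 2) powr (p - 1) * (t / 2) = (t / 2) powr p"
        using assms by (simp add: powr_diff)
      ultimately show ?thesis by (metis mult.assoc)
    qed
    ultimately have "(t / 2) powr p * m \<le> \<theta> powr (p - 1) * v" by (simp only:)
    then show ?thesis using v by (simp add: V_def[symmetric] ennreal_mult[symmetric] ennreal_leI)
  qed
qed

lemma mult_le_of_less_divide:
  fixes I m t :: ennreal
  assumes "t < I / m" "0 < m" "m < \<infinity>"
  shows "t * m \<le> I"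
proof -
  have "t * m \<le> I / m * m" using assms by (intro mult_right_mono) auto
  also have "\<dots> = I" using assms by (simp add: ennreal_divide_times ennreal_divide_self)
  finally show ?thesis .
qed

section \<open>Stars and forks\<close>

datatype node = Hub | Mid nat | Leaf nat

instance node :: countable by countable_datatype

text \<open>Stars and forks share one node set, so that a single mass function serves both; in a
  star every intermediate point has distance 2 from all other nodes.\<close>

definition nodes :: "nat \<Rightarrow> node set" where
  "nodes n = insert Hub (Mid ` {..<n} \<union> Leaf ` {..<n})"

text \<open>The value \<open>(1 + D) / 2\<close> in forks lies between \<open>D - 1\<close> (triangle inequality between \<open>Mid i\<close> and
  \<open>Leaf k\<close> through \<open>Hub\<close>) and \<open>min D 2\<close>; being at most \<open>D\<close>, it makes every ball around a leaf that
  contains more than \<open>{Leaf i, Mid i}\<close> contain all leaves.\<close>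

definition node_dist :: "bool \<Rightarrow> real \<Rightarrow> node \<Rightarrow> node \<Rightarrow> real" where
  "node_dist st D u v = (if u = v then 0 else if st then
     (case (u, v) of (Hub, Leaf _) \<Rightarrow> 1 | (Leaf _, Hub) \<Rightarrow> 1 | (Leaf _, Leaf _) \<Rightarrow> D | _ \<Rightarrow> 2)
   else
     (case (u, v) of (Hub, Mid _) \<Rightarrow> 1 | (Mid _, Hub) \<Rightarrow> 1 | (Mid _, Mid _) \<Rightarrow> 2
      | (Mid i, Leaf k) \<Rightarrow> if i = k then 1 else D | (Leaf k, Mid i) \<Rightarrow> if i = k then 1 else D
      | _ \<Rightarrow> (1 + D) / 2))"

lemma node_dist_commute: "node_dist st D u v = node_dist st D v u"
  by (auto simp: node_dist_def split: node.splits)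

lemma node_dist_ge_1: "1 \<le> D \<Longrightarrow> u \<noteq> v \<Longrightarrow> 1 \<le> node_dist st D u v"
  by (auto simp: node_dist_def split: node.splits)

lemma node_dist_le_3: "1 \<le> D \<Longrightarrow> D \<le> 3 \<Longrightarrow> node_dist st D u v \<le> 3"
  by (auto simp: node_dist_def split: node.splits)

lemma node_dist_nonneg: "1 \<le> D \<Longrightarrow> 0 \<le> node_dist st D u v"
  by (auto simp: node_dist_def split: node.splits)

lemma node_dist_triangle:
  assumes "1 \<le> D" "D \<le> 3" "st \<Longrightarrow> D \<le> 2"
  shows "node_dist st D u v \<le> node_dist st D u x + node_dist st D x v"
proof -
  define E where "E = (1 + D) / 2"
  \<comment> \<open>\<open>E \<le> 2\<close> is where \<open>D \<le> 3\<close> enters: in a fork the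
    hub reaches each leaf through its intermediate point in two unit steps.\<close>
  have E: "1 \<le> E" "E \<le> D" "D \<le> 1 + E" "E \<le> 2" using assms by (auto simp: E_def field_simps)
  show ?thesis
    using assms E unfolding node_dist_def E_def[symmetric]
    by (cases st; cases u; cases v; cases x) simp_all
qed

text \<open>Case \<open>single\<close> is the only harmful one. It arises when the radius is above 1
  and the dilated radius at most \<open>D\<close>, hence \<open>\<kappa> < D\<close>; the disjunct
  \<open>st \<or> u \<noteq> v\<close> records that in a fork such a ball is not centred at the leaf
  itself, which hides forks from the centred operator. In case \<open>core\<close> the dilation
  contains a heavy node: the hub, or the centre if that is a leaf.\<close>

lemma node_ball_cases:
  assumes "1 \<le> D" "1 \<le> \<kappa>" "0 < s" "node_dist st D u v < s"
  obtains (fiber) "\<And>u'. node_dist st D u u' < s \<Longrightarrow> u' = v \<or> (\<exists>i. v = Leaf i \<and> u' = Mid i)"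
    | (leaves) "\<And>i. node_dist st D u (Leaf i) < \<kappa> * s"
    | (core) "\<And>i. v \<noteq> Leaf i" "node_dist st D u Hub < \<kappa> * s \<or> (\<exists>i. u = Leaf i)"
    | (single) i where "\<kappa> < D" "st \<or> u \<noteq> v" "v = Leaf i" "\<And>k. node_dist st D u (Leaf k) < s \<Longrightarrow> k = i"
proof -
  have s: "s \<le> \<kappa> * s" using assms by simp
  have s': "c < \<kappa> * s" if "c < s" for c using that s by linarith
  have D: "\<kappa> < D" if "1 < s" "\<kappa> * s \<le> D"
  proof -
    have "\<kappa> * 1 < \<kappa> * s" using assms that by (intro mult_strict_left_mono) auto
    then show ?thesis using that by simp
  qed
  note nd = node_dist_def
  have singleton: thesis if "\<And>u'. u' \<noteq> u \<Longrightarrow> s \<le> node_dist st D u u'"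
    by (rule fiber) (metis that assms(4) not_less)
  show ?thesis
  proof (cases st)
    case True
    show ?thesis
    proof (cases u)
      case Hub
      show ?thesis
      proof (cases "s \<le> 1")
        case True
        then show ?thesis using assms(1) node_dist_ge_1 by (intro singleton) (metis order_trans)
      next
        case False
        then show ?thesis using \<open>st\<close> Hub by (intro leaves) (simp add: nd s')
      qed
    next
      case (Mid k)
      show ?thesis
      proof (cases "s \<le> 2")
        case True
        then show ?thesis using \<open>st\<close> Mid by (intro singleton) (simp add: nd)
      next
        case False
        then show ?thesis using \<open>st\<close> Mid by (intro leaves) (simp add: nd s')
      qed
    next
      case (Leaf k)
      show ?thesis
      proof (cases "s \<le> 1")
        case True
        then show ?thesis using assms(1) node_dist_ge_1 by (intro singleton) (metis order_trans)
      next
        case s1: False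
        show ?thesis
        proof (cases "D < \<kappa> * s")
          case True
          then show ?thesis using \<open>st\<close> Leaf assms by (intro leaves) (simp add: nd s')
        next
          case False
          then have "\<kappa> < D" "s \<le> D" using D s s1 by linarith+
          then have *: "i = k" if "node_dist st D u (Leaf i) < s" for i
            using that \<open>st\<close> Leaf by (simp add: nd split: if_splits)
          show ?thesis
          proof (cases "\<exists>i. v = Leaf i")
            case True
            then have "v = Leaf k" using * assms by auto
            then show ?thesis using * \<open>st\<close> \<open>\<kappa> < D\<close> single by blast
          next
            case False
            then show ?thesis using Leaf core by blast
          qed
        qed
      qed
    qed
  next
    case False
    show ?thesis
    proof (cases "s \<le> 1")
      case True
      then show ?thesis using assms(1) node_dist_ge_1 by (intro singleton) (metis order_trans)
    next
      case s1: False
      show ?thesis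
      proof (cases v)
        case Hub
        have "node_dist st D u Hub < \<kappa> * s \<or> (\<exists>i. u = Leaf i)"
          using \<open>\<not> st\<close> s1 by (cases u) (auto simp: nd s')
        then show ?thesis using Hub core by blast
      next
        case (Mid i)
        have "node_dist st D u Hub < \<kappa> * s \<or> (\<exists>i. u = Leaf i)"
          using \<open>\<not> st\<close> s1 by (cases u) (auto simp: nd s')
        then show ?thesis using Mid core by blast
      next
        case v: (Leaf i)
        show ?thesis
        proof (cases u)
          case Hub
          then have "(1 + D) / 2 < s" using assms v \<open>\<not> st\<close> by (simp add: nd)
          then show ?thesis using \<open>\<not> st\<close> Hub s'[of "(1 + D) / 2"] by (intro leaves) (simp add: nd)
        next
          case (Mid k)
          show ?thesis
          proof (cases "D < \<kappa> * s")
            case True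
            then show ?thesis using \<open>\<not> st\<close> Mid assms by (intro leaves) (simp add: nd s')
          next
            case False
            then have "\<kappa> < D" "s \<le> D" using D s s1 by linarith+
            then have *: "n = k" if "node_dist st D u (Leaf n) < s" for n
              using that \<open>\<not> st\<close> Mid by (simp add: nd split: if_splits)
            then have "i = k" using assms v by blast
            show ?thesis by (rule single[of i]) (use * \<open>i = k\<close> v \<open>\<kappa> < D\<close> Mid in auto)
          qed
        next
          case (Leaf k)
          show ?thesis
          proof (cases "s \<le> (1 + D) / 2")
            case True
            then have "s \<le> D" using assms(1) by simp
            have "i = k" using assms(4) True v Leaf \<open>\<not> st\<close> by (simp add: nd split: if_splits)
            moreover have "u' = Leaf k \<or> u' = Mid k" if "node_dist st D u u' < s" for u'
              using that True \<open>s \<le> D\<close> Leaf \<open>\<not> st\<close> by (cases u') (simp_all add: nd split: if_splits)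
            ultimately show ?thesis using v fiber by blast
          next
            case False
            then show ?thesis using \<open>\<not> st\<close> Leaf assms s'[of "(1 + D) / 2"] by (intro leaves) (simp add: nd)
          qed
        qed
      qed
    qed
  qed
qed

section \<open>The metric measure space assembled from components\<close>

text \<open>\<open>dec\<close> leaves the carrier abstract: the points may be reals, while all
  computations take place in pairs of component index and node.\<close>

locale components =
  fixes X :: "'a set" and dec :: "'a \<Rightarrow> nat \<times> node"
    and star :: "nat \<Rightarrow> bool" and D w :: "nat \<Rightarrow> real" and N :: "nat \<Rightarrow> nat"
  assumes dec: "bij_betw dec X {(j, u). u \<in> nodes (N j)}"
    and D: "1 \<le> D j" "D j \<le> 3" "star j \<Longrightarrow> D j \<le> 2"
    and N: "1 \<le> N j"
    and w: "0 < w j" "w j \<le> 1"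
begin

definition rho :: "'a \<Rightarrow> 'a \<Rightarrow> real" where
  "rho x y = (if fst (dec x) = fst (dec y)
     then node_dist (star (fst (dec x))) (D (fst (dec x))) (snd (dec x)) (snd (dec y)) else 4)"

text \<open>The leaves of component \<open>j\<close> together weigh \<open>(1 / 2) ^ j\<close>.
  Summability is required since balls of radius above 4 are the whole space and must have finite
  measure.\<close>

definition leaf_mass :: "nat \<Rightarrow> real" where
  "leaf_mass j = (1 / 2) ^ j / N j"

text \<open>All intermediate points together weigh as much as the hub, so the core has weight
  \<open>2 * w\<close> in units of \<open>leaf_mass\<close> and the hub is half of it.\<close>

definition mass :: "nat \<times> node \<Rightarrow> real" where
  "mass q = leaf_mass (fst q) * (case snd q of Hub \<Rightarrow> w (fst q) | Mid _ \<Rightarrow> w (fst q) / N (fst q) | Leaf _ \<Rightarrow> 1)"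

definition mu :: "'a measure" where
  "mu = density (count_space X) (\<lambda>x. ennreal (mass (dec x)))"

definition cell :: "nat \<Rightarrow> node set \<Rightarrow> 'a set" where
  "cell j U = {x\<in>X. fst (dec x) = j \<and> snd (dec x) \<in> U}"

abbreviation "leaves j \<equiv> cell j (range Leaf)"
abbreviation "core j \<equiv> cell j (- range Leaf)"
abbreviation "component j \<equiv> cell j UNIV"

text \<open>In a fork, a small ball around a leaf may contain the intermediate point of that leaf.
  Fibers allow for this and are still disjoint over leaves, and over core points, so bounds on them
  can be added.\<close>

definition fiber :: "'a \<Rightarrow> 'a set" where
  "fiber x = {y\<in>X. dec y = dec x \<or> (\<exists>i. snd (dec x) = Leaf i \<and> dec y = (fst (dec x), Mid i))}"

lemma dec_eq_iff: "x \<in> X \<Longrightarrow> y \<in> X \<Longrightarrow> dec x = dec y \<longleftrightarrow> x = y"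
  using inj_on_eq_iff[OF bij_betw_imp_inj_on[OF dec]] .

lemma dec_mem: "x \<in> X \<Longrightarrow> snd (dec x) \<in> nodes (N (fst (dec x)))"
  using bij_betw_apply[OF dec, of x] by (simp add: case_prod_beta)

lemma dec_surj: "u \<in> nodes (N j) \<Longrightarrow> \<exists>x\<in>X. dec x = (j, u)"
proof -
  assume "u \<in> nodes (N j)"
  then have "(j, u) \<in> dec ` X" using bij_betw_imp_surj_on[OF dec] by simp
  then show ?thesis by auto
qed

lemma leaf_mass_pos: "0 < leaf_mass j"
  using N[of j] by (simp add: leaf_mass_def)

lemma mass_pos: "0 < mass q"
  using leaf_mass_pos[of "fst q"] N[of "fst q"] w[of "fst q"] by (simp add: mass_def split: node.split)

lemma finite_nodes: "finite (nodes n)"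
  by (simp add: nodes_def)

lemma bij_betw_cell: "bij_betw (\<lambda>x. snd (dec x)) (cell j U) (U \<inter> nodes (N j))"
proof (rule bij_betwI')
  fix x y assume "x \<in> cell j U" "y \<in> cell j U"
  then show "snd (dec x) = snd (dec y) \<longleftrightarrow> x = y"
    using dec_eq_iff[of x y] by (auto simp: cell_def prod_eq_iff)
next
  fix x assume "x \<in> cell j U"
  then show "snd (dec x) \<in> U \<inter> nodes (N j)" using dec_mem by (auto simp: cell_def)
next
  fix u assume "u \<in> U \<inter> nodes (N j)"
  then obtain x where "x \<in> X" "dec x = (j, u)" using dec_surj by blast
  then show "\<exists>x\<in>cell j U. u = snd (dec x)" using \<open>u \<in> _\<close> by (auto simp: cell_def intro!: bexI[of _ x])
qed

lemma finite_cell: "finite (cell j U)"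
  using bij_betw_finite[OF bij_betw_cell] finite_nodes by blast

lemma cell_subset: "cell j U \<subseteq> X"
  by (auto simp: cell_def)

lemma space_mu [simp]: "space mu = X"
  by (simp add: mu_def)

lemma sets_mu [simp]: "sets mu = Pow X"
  by (simp add: mu_def)

lemma measurable_mu: "f \<in> borel_measurable mu"
  by (auto simp: measurable_def)

lemma emeasure_singleton: "x \<in> X \<Longrightarrow> emeasure mu {x} = ennreal (mass (dec x))"
  by (simp add: mu_def emeasure_density nn_integral_count_space_indicator[symmetric] nn_integral_count_space_finite)

lemma emeasure_cell: "emeasure mu (cell j U) = ennreal (\<Sum>u\<in>U \<inter> nodes (N j). mass (j, u))"
proof -
  have "emeasure mu (cell j U) = (\<Sum>x\<in>cell j U. emeasure mu {x})"
    using cell_subset finite_cell by (intro emeasure_eq_sum_singleton) auto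
  also have "\<dots> = (\<Sum>x\<in>cell j U. ennreal (mass (j, snd (dec x))))"
    by (intro sum.cong) (auto simp: emeasure_singleton cell_def intro!: arg_cong[of _ _ mass])
  also have "\<dots> = (\<Sum>u\<in>U \<inter> nodes (N j). ennreal (mass (j, u)))"
    by (rule sum.reindex_bij_betw[OF bij_betw_cell])
  finally show ?thesis using mass_pos by (simp add: sum_ennreal less_imp_le)
qed

lemma emeasure_leaves: "emeasure mu (leaves j) = ennreal (N j * leaf_mass j)"
proof -
  have "range Leaf \<inter> nodes (N j) = Leaf ` {..<N j}" by (auto simp: nodes_def)
  moreover have "(\<Sum>u\<in>Leaf ` {..<N j}. mass (j, u)) = N j * leaf_mass j"
    by (subst sum.reindex) (auto simp: mass_def inj_on_def)
  ultimately show ?thesis by (simp add: emeasure_cell)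
qed

lemma emeasure_core: "emeasure mu (core j) = ennreal (2 * w j * leaf_mass j)"
proof -
  have "- range Leaf \<inter> nodes (N j) = insert Hub (Mid ` {..<N j})" by (auto simp: nodes_def)
  moreover have "(\<Sum>u\<in>Mid ` {..<N j}. mass (j, u)) = w j * leaf_mass j"
    using N[of j] by (subst sum.reindex) (auto simp: mass_def inj_on_def)
  ultimately show ?thesis by (simp add: emeasure_cell image_iff) (simp add: mass_def algebra_simps)
qed

lemma component_eq: "component j = leaves j \<union> core j" and leaves_Int_core: "leaves j \<inter> core j = {}"
  by (auto simp: cell_def)

lemma emeasure_component: "emeasure mu (component j) \<le> ennreal (3 * (1 / 2) ^ j)"
proof -
  have "emeasure mu (component j) = emeasure mu (leaves j) + emeasure mu (core j)"
    unfolding component_eq using leaves_Int_core cell_subset by (intro plus_emeasure[symmetric]) auto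
  also have "\<dots> = ennreal (N j * leaf_mass j + 2 * w j * leaf_mass j)"
    using leaf_mass_pos[of j] w[of j] by (simp add: emeasure_leaves emeasure_core)
  also have "\<dots> \<le> ennreal (3 * (1 / 2) ^ j)"
  proof (rule ennreal_leI)
    have "w j \<le> N j" using w[of j] N[of j] by linarith
    then have "N j * leaf_mass j + 2 * w j * leaf_mass j \<le> N j * leaf_mass j + 2 * N j * leaf_mass j"
      using leaf_mass_pos[of j] by (intro add_left_mono mult_right_mono) auto
    also have "\<dots> = 3 * (1 / 2) ^ j" using N[of j] by (simp add: leaf_mass_def)
    finally show "N j * leaf_mass j + 2 * w j * leaf_mass j \<le> 3 * (1 / 2) ^ j" .
  qed
  finally show ?thesis .
qed

lemma Union_component: "(\<Union>j. component j) = X" and disjoint_component: "disjoint_family component"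
  by (auto simp: cell_def disjoint_family_on_def)

lemma emeasure_X_finite: "emeasure mu X < \<infinity>"
proof -
  have "range (\<lambda>j. component j) \<subseteq> sets mu" using cell_subset by auto
  from suminf_emeasure[OF this disjoint_component] have "emeasure mu X = (\<Sum>j. emeasure mu (component j))"
    by (simp only: Union_component)
  also have "\<dots> \<le> (\<Sum>j. ennreal (3 * (1 / 2) ^ j))"
    by (intro suminf_le emeasure_component) auto
  also have "\<dots> = ennreal (\<Sum>j. 3 * (1 / 2) ^ j)"
    by (intro suminf_ennreal_eq sums_ennreal[THEN iffD2] summable_sums summable_mult summable_geometric) auto
  also have "\<dots> < \<infinity>" by simp
  finally show ?thesis .
qed

sublocale finite_measure mu
  by standard (use emeasure_X_finite in simp)

lemma rho_commute: "rho x y = rho y x"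
  by (simp add: rho_def node_dist_commute)

lemma rho_ge_1: "x \<in> X \<Longrightarrow> y \<in> X \<Longrightarrow> x \<noteq> y \<Longrightarrow> 1 \<le> rho x y"
  using dec_eq_iff[of x y] node_dist_ge_1[OF D(1), of "snd (dec x)" "snd (dec y)"]
  by (auto simp: rho_def prod_eq_iff)

lemma rho_le_4: "rho x y \<le> 4"
proof -
  have "node_dist st (D j) u v \<le> 4" for st j u v
    using node_dist_le_3[OF D(1,2)[of j], of st u v] by linarith
  then show ?thesis by (simp add: rho_def)
qed

lemma rho_nonneg: "0 \<le> rho x y"
  using node_dist_nonneg[OF D(1)] by (simp add: rho_def)

lemma rho_triangle: "rho x z \<le> rho x y + rho y z"
proof (cases "fst (dec x) = fst (dec y) \<and> fst (dec y) = fst (dec z)")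
  case True
  then show ?thesis using node_dist_triangle[OF D] by (simp add: rho_def)
next
  case False
  then have "rho x y = 4 \<or> rho y z = 4" by (auto simp: rho_def)
  then show ?thesis using rho_le_4[of x z] rho_nonneg[of x y] rho_nonneg[of y z] by linarith
qed

lemma rho_self: "rho x x = 0"
  by (simp add: rho_def node_dist_def)

sublocale rho: Metric_space X rho
proof
  fix x y assume "x \<in> X" "y \<in> X"
  then show "rho x y = 0 \<longleftrightarrow> x = y" using rho_ge_1[of x y] rho_self[of x] by (cases "x = y") auto
qed (rule rho_nonneg rho_commute rho_triangle)+

lemma mball_eq: "x \<in> X \<Longrightarrow> rho.mball x s = {y\<in>X. rho x y < s}"
  by (auto simp: rho.mball_def)

text \<open>Distinct points are at distance at least 1, so unit balls are singletons and the
  topology is discrete; all subsets are then Borel.\<close>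

lemma openin_rho: "openin rho.mtopology U \<longleftrightarrow> U \<subseteq> X"
proof -
  have "rho.mball x 1 \<subseteq> {x}" if "x \<in> X" for x
    using that rho_ge_1[of x] by (force simp: mball_eq)
  then show ?thesis unfolding rho.openin_mtopology
    by (metis (no_types, lifting) empty_subsetI in_mono insert_subset order_trans zero_less_one)
qed

lemma emeasure_pos:
  assumes "A \<subseteq> X" "x \<in> A"
  shows "0 < emeasure mu A"
proof -
  have "0 < emeasure mu {x}" using assms mass_pos by (simp add: emeasure_singleton subset_iff)
  also have "\<dots> \<le> emeasure mu A" using assms by (intro emeasure_mono) auto
  finally show ?thesis .
qed

lemma mms_rho: "mms X rho mu"
  unfolding mms_def
proof (intro conjI ballI allI impI)
  show "X \<noteq> {}" using dec_surj[of Hub 0] by (auto simp: nodes_def)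
  show "Metric_space X rho" by (rule rho.Metric_space_axioms)
  show "sets mu = sigma_sets X {U. openin rho.mtopology U}"
    using sigma_algebra.sigma_sets_eq[OF sigma_algebra_Pow, of X] by (simp add: openin_rho Pow_def)
  fix x and s :: real assume xs: "x \<in> X" "0 < s"
  show "0 < emeasure mu (rho.mball x s)"
    by (rule emeasure_pos[of _ x]) (use xs in auto)
  show "emeasure mu (rho.mball x s) < \<infinity>"
    using emeasure_finite[of "rho.mball x s"] by (simp only: infinity_ennreal_def less_top)
qed simp

subsection \<open>Upper bounds\<close>

text \<open>Here \<open>B\<close> is a ball containing \<open>x\<close> and \<open>B'\<close> its dilation. Only the last alternative can make the
  weak type constant large; \<open>J\<close> collects the components in which it occurs.\<close>

definition admissible :: "nat set \<Rightarrow> 'a \<Rightarrow> 'a set \<Rightarrow> 'a set \<Rightarrow> bool" where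
  "admissible J x B B' \<longleftrightarrow> x \<in> B \<and> B \<subseteq> B' \<and> B' \<subseteq> X \<and> (B' = X \<or>
     B \<subseteq> component (fst (dec x)) \<and>
       (B \<subseteq> fiber x \<or> leaves (fst (dec x)) \<subseteq> B' \<or>
        x \<in> core (fst (dec x)) \<and> (\<exists>y\<in>B'. fst (dec y) = fst (dec x) \<and> snd (dec y) \<in> insert Hub (range Leaf)) \<or>
        fst (dec x) \<in> J \<and> B \<inter> leaves (fst (dec x)) = {x}))"

lemma self_in_fiber: "x \<in> X \<Longrightarrow> x \<in> fiber x"
  by (auto simp: fiber_def)

lemma disjoint_fiber_leaves: "disjoint_family_on fiber (leaves j)"
  by (auto simp: disjoint_family_on_def fiber_def cell_def) (metis dec_eq_iff node.distinct(5) node.inject(1) prod.collapse snd_conv fst_conv)+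

lemma disjoint_fiber_core: "disjoint_family_on fiber (core j)"
  by (auto simp: disjoint_family_on_def fiber_def cell_def) (metis dec_eq_iff)+

section \<open>Local estimates for the measure with density \<open>|f| powr p\<close>\<close>

context
  fixes f :: "'a \<Rightarrow> real" and p :: real
begin

text \<open>Turning the integral of the \<open>p\<close>-th power into a measure lets local
  estimates be added over disjoint sets.\<close>

definition nu :: "'a measure" where
  "nu = density mu (\<lambda>x. ennreal (\<bar>f x\<bar> powr p))"

lemma sets_nu [simp]: "sets nu = Pow X"
  by (simp add: nu_def)

lemma emeasure_nu: "A \<subseteq> X \<Longrightarrow> emeasure nu A = (\<integral>\<^sup>+x\<in>A. ennreal (\<bar>f x\<bar> powr p) \<partial>mu)"
  unfolding nu_def by (rule emeasure_density) (auto intro: measurable_mu)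

lemma emeasure_nu_X: "emeasure nu X = (\<integral>\<^sup>+x. ennreal (\<bar>f x\<bar> powr p) \<partial>mu)"
  by (subst emeasure_nu) (auto intro!: nn_integral_cong)

text \<open>The case \<open>\<theta> = 1\<close> of \<open>powr_integral_lower_bound\<close>. The
  constant is weakened from \<open>t / 2\<close> to \<open>t / 4\<close> to agree with
  \<open>nu_ge_leaf_ball\<close>, where the integral is halved once more.\<close>

lemma nu_ge_ball:
  assumes "1 \<le> p" "0 < t" "B \<subseteq> B'" "B' \<subseteq> X" "ennreal t * emeasure mu B' \<le> (\<integral>\<^sup>+x\<in>B. ennreal \<bar>f x\<bar> \<partial>mu)"
  shows "ennreal ((t / 4) powr p) * emeasure mu B' \<le> emeasure nu B"
proof -
  have "ennreal ((t / 2) powr p * measure mu B')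
      \<le> ennreal (1 powr (p - 1)) * (\<integral>\<^sup>+x\<in>B. ennreal (\<bar>f x\<bar> powr p) \<partial>mu)"
  proof (rule powr_integral_lower_bound)
    show "emeasure mu B \<le> ennreal (1 * measure mu B')"
      using assms emeasure_mono[of B B' mu] by (simp add: emeasure_eq_measure)
    show "ennreal (t * measure mu B') \<le> (\<integral>\<^sup>+x\<in>B. ennreal \<bar>f x\<bar> \<partial>mu)"
      using assms by (simp add: emeasure_eq_measure ennreal_mult)
  qed (use assms measurable_mu in auto)
  then have "ennreal ((t / 2) powr p) * emeasure mu B' \<le> emeasure nu B"
    using assms by (simp add: emeasure_nu emeasure_eq_measure ennreal_mult)
  moreover have "ennreal ((t / 4) powr p) * emeasure mu B' \<le> ennreal ((t / 2) powr p) * emeasure mu B'"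
    using assms by (intro mult_right_mono ennreal_leI powr_mono2) auto
  ultimately show ?thesis by (rule order_trans[rotated])
qed

text \<open>Adds bounds over disjoint fibers. Leaves and core points are kept apart because the
  fiber of a leaf meets the fiber of its intermediate point.\<close>

lemma emeasure_le_nu_component:
  assumes "A \<subseteq> X" "A \<subseteq> leaves j \<or> A \<subseteq> core j" "\<And>x. x \<in> A \<Longrightarrow> c * emeasure mu {x} \<le> emeasure nu (fiber x)"
  shows "c * emeasure mu A \<le> emeasure nu (component j)"
proof -
  have A: "finite A" using assms(2) finite_cell finite_subset by blast
  have "c * emeasure mu A = (\<Sum>x\<in>A. c * emeasure mu {x})"
    using assms(1) A by (subst emeasure_eq_sum_singleton) (auto simp: sum_distrib_left)
  also have "\<dots> \<le> (\<Sum>x\<in>A. emeasure nu (fiber x))" by (intro sum_mono assms)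
  also have "\<dots> = emeasure nu (\<Union>x\<in>A. fiber x)"
  proof (rule sum_emeasure)
    show "disjoint_family_on fiber A"
      using assms(2) disjoint_fiber_core disjoint_fiber_leaves disjoint_family_on_mono by metis
  qed (use A in \<open>auto simp: fiber_def\<close>)
  also have "\<dots> \<le> emeasure nu (component j)"
    using assms(2) by (intro emeasure_mono) (auto simp: fiber_def cell_def)
  finally show ?thesis .
qed

lemma emeasure_leaf: "x \<in> leaves j \<Longrightarrow> emeasure mu {x} = ennreal (leaf_mass j)"
  by (auto simp: cell_def emeasure_singleton mass_def)

text \<open>The ball sees one leaf and part of the core, so one of the two carries half of the
  integral. If the core does, its small mass gives the factor \<open>(2 * w j) powr (p - 1)\<close>,
  and the resulting bound no longer depends on \<open>x\<close>: multiplied by \<open>N j\<close> it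
  covers all leaves at once.\<close>

lemma nu_ge_leaf_ball:
  assumes "1 \<le> p" "0 < t" "B' \<subseteq> X" "B \<subseteq> component j" "B \<subseteq> B'" "B \<inter> leaves j = {x}"
    and K: "real (N j) * w j powr (p - 1) \<le> K"
    and large: "ennreal t * emeasure mu B' \<le> (\<integral>\<^sup>+x\<in>B. ennreal \<bar>f x\<bar> \<partial>mu)"
  shows "ennreal ((t / 4) powr p) * emeasure mu {x} \<le> emeasure nu (fiber x)
    \<or> ennreal ((t / 4) powr p) * emeasure mu (leaves j) \<le> ennreal (2 powr (p - 1) * K) * emeasure nu (component j)"
proof -
  have x: "x \<in> leaves j" "x \<in> X" "x \<in> B'" using assms by (auto simp: cell_def)
  have "ennreal (t * leaf_mass j) \<le> ennreal t * emeasure mu B'"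
  proof -
    have "ennreal (t * leaf_mass j) = ennreal t * emeasure mu {x}"
      using leaf_mass_pos[of j] assms by (simp add: emeasure_leaf[OF x(1)] ennreal_mult)
    also have "\<dots> \<le> ennreal t * emeasure mu B'" using x assms by (intro mult_left_mono emeasure_mono) auto
    finally show ?thesis .
  qed
  also note large
  also have "(\<integral>\<^sup>+y\<in>B. ennreal \<bar>f y\<bar> \<partial>mu) \<le> (\<integral>\<^sup>+y. ennreal \<bar>f y\<bar> * indicator {x} y + ennreal \<bar>f y\<bar> * indicator (core j) y \<partial>mu)"
  proof (rule nn_integral_mono)
    fix y
    have "y \<in> {x} \<union> core j" if "y \<in> B" using that assms(4,6) by (auto simp: cell_def)
    then show "ennreal \<bar>f y\<bar> * indicator B y \<le> ennreal \<bar>f y\<bar> * indicator {x} y + ennreal \<bar>f y\<bar> * indicator (core j) y"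
      by (auto split: split_indicator)
  qed
  also have "\<dots> = (\<integral>\<^sup>+y\<in>{x}. ennreal \<bar>f y\<bar> \<partial>mu) + (\<integral>\<^sup>+y\<in>core j. ennreal \<bar>f y\<bar> \<partial>mu)"
    by (intro nn_integral_add measurable_mu)
  finally have sum: "ennreal (t * leaf_mass j) \<le> (\<integral>\<^sup>+y\<in>{x}. ennreal \<bar>f y\<bar> \<partial>mu) + (\<integral>\<^sup>+y\<in>core j. ennreal \<bar>f y\<bar> \<partial>mu)" .
  have "ennreal (t / 2 * leaf_mass j) \<le> (\<integral>\<^sup>+y\<in>{x}. ennreal \<bar>f y\<bar> \<partial>mu) \<or> ennreal (t / 2 * leaf_mass j) \<le> (\<integral>\<^sup>+y\<in>core j. ennreal \<bar>f y\<bar> \<partial>mu)"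
  proof (rule ccontr)
    assume "\<not> ?thesis"
    then have "(\<integral>\<^sup>+y\<in>{x}. ennreal \<bar>f y\<bar> \<partial>mu) + (\<integral>\<^sup>+y\<in>core j. ennreal \<bar>f y\<bar> \<partial>mu) < ennreal (t / 2 * leaf_mass j) + ennreal (t / 2 * leaf_mass j)"
      by (intro add_strict_mono) auto
    also have "\<dots> = ennreal (t * leaf_mass j)"
      using leaf_mass_pos[of j] assms by (subst ennreal_plus[symmetric]) auto
    finally show False using sum by simp
  qed
  then show ?thesis
  proof
    assume *: "ennreal (t / 2 * leaf_mass j) \<le> (\<integral>\<^sup>+y\<in>{x}. ennreal \<bar>f y\<bar> \<partial>mu)"
    have "ennreal ((t / 2 / 2) powr p * leaf_mass j) \<le> ennreal (1 powr (p - 1)) * (\<integral>\<^sup>+y\<in>{x}. ennreal (\<bar>f y\<bar> powr p) \<partial>mu)"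
      by (rule powr_integral_lower_bound) (use * x assms leaf_mass_pos[of j] measurable_mu emeasure_leaf in auto)
    then have "ennreal ((t / 4) powr p) * emeasure mu {x} \<le> emeasure nu {x}"
      using x leaf_mass_pos[of j] by (simp add: emeasure_leaf emeasure_nu ennreal_mult)
    also have "\<dots> \<le> emeasure nu (fiber x)" using self_in_fiber[OF x(2)] by (intro emeasure_mono) (auto simp: fiber_def)
    finally show ?thesis by blast
  next
    assume *: "ennreal (t / 2 * leaf_mass j) \<le> (\<integral>\<^sup>+y\<in>core j. ennreal \<bar>f y\<bar> \<partial>mu)"
    have "ennreal ((t / 2 / 2) powr p * leaf_mass j) \<le> ennreal ((2 * w j) powr (p - 1)) * (\<integral>\<^sup>+y\<in>core j. ennreal (\<bar>f y\<bar> powr p) \<partial>mu)"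
      by (rule powr_integral_lower_bound)
        (use * assms leaf_mass_pos[of j] w[of j] measurable_mu emeasure_core[of j] cell_subset in auto)
    then have **: "ennreal ((t / 4) powr p * leaf_mass j) \<le> ennreal ((2 * w j) powr (p - 1)) * emeasure nu (core j)"
      using cell_subset by (simp add: emeasure_nu)
    have "ennreal ((t / 4) powr p) * emeasure mu (leaves j) = ennreal (N j) * ennreal ((t / 4) powr p * leaf_mass j)"
      using leaf_mass_pos[of j] by (simp add: emeasure_leaves ennreal_mult[symmetric] mult_ac)
    also have "\<dots> \<le> ennreal (N j) * (ennreal ((2 * w j) powr (p - 1)) * emeasure nu (core j))"
      by (rule mult_left_mono[OF **]) simp
    also have "\<dots> = ennreal (2 powr (p - 1) * (N j * w j powr (p - 1))) * emeasure nu (core j)"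
      using w[of j] by (simp add: powr_mult ennreal_mult mult_ac)
    also have "\<dots> \<le> ennreal (2 powr (p - 1) * K) * emeasure nu (component j)"
      using K by (intro mult_mono ennreal_leI mult_left_mono emeasure_mono) (auto simp: cell_def)
    finally show ?thesis by blast
  qed
qed

end

text \<open>Every point of \<open>E\<close> in the component yields a bound for its own fiber, for
  all leaves, or, at core points, for the mass \<open>w j * leaf_mass j\<close>. One instance of the
  second kind settles the component, one of the third settles the core; otherwise the fiber bounds
  are added.\<close>

lemma component_estimate:
  assumes p: "1 \<le> p" and t: "0 < t" and K: "0 \<le> K" "\<And>j. j \<in> J \<Longrightarrow> real (N j) * w j powr (p - 1) \<le> K"
    and E: "E \<subseteq> X" "\<And>x. x \<in> E \<Longrightarrow> \<exists>B B'. admissible J x B B' \<and> B' \<noteq> X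
        \<and> ennreal t * emeasure mu B' \<le> (\<integral>\<^sup>+y\<in>B. ennreal \<bar>f y\<bar> \<partial>mu)"
  shows "ennreal ((t / 4) powr p) * emeasure mu (E \<inter> component j)
    \<le> ennreal (3 * (1 + 2 powr (p - 1) * K)) * emeasure (nu f p) (component j)"
proof -
  define s where "s = ennreal ((t / 4) powr p)"
  define c where "c = 1 + 2 powr (p - 1) * K"
  define V where "V = emeasure (nu f p) (component j)"
  have c: "1 \<le> c" using K by (simp add: c_def)
  have V_le: "V \<le> ennreal c * V" using mult_right_mono[of 1 "ennreal c" V] c by simp
  have cV: "k * V \<le> ennreal (3 * c) * V" if "k \<le> 3" for k :: ennreal
  proof (rule mult_right_mono)
    have "k \<le> ennreal 3" using that by simp
    also have "\<dots> \<le> ennreal (3 * c)" using c by (intro ennreal_leI) simp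
    finally show "k \<le> ennreal (3 * c)" .
  qed simp
  have cases: "s * emeasure mu {x} \<le> emeasure (nu f p) (fiber x) \<or> s * emeasure mu (leaves j) \<le> ennreal c * V
      \<or> x \<in> core j \<and> s * ennreal (w j * leaf_mass j) \<le> V" if "x \<in> E \<inter> component j" for x
  proof -
    have x: "x \<in> E" "x \<in> X" "fst (dec x) = j" using that by (auto simp: cell_def)
    obtain B B' where B: "admissible J x B B'" "B' \<noteq> X"
        and large: "ennreal t * emeasure mu B' \<le> (\<integral>\<^sup>+y\<in>B. ennreal \<bar>f y\<bar> \<partial>mu)"
      using E(2)[OF x(1)] by blast
    have sub: "x \<in> B" "B \<subseteq> B'" "B' \<subseteq> X" "B \<subseteq> component j"
      using B x by (auto simp: admissible_def)
    have ball: "s * emeasure mu B' \<le> emeasure (nu f p) B"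
      unfolding s_def by (rule nu_ge_ball[OF p t sub(2,3) large])
    have nu_mono: "emeasure (nu f p) B \<le> emeasure (nu f p) A" if "B \<subseteq> A" "A \<subseteq> X" for A
      using that by (intro emeasure_mono) auto
    have mu_mono: "s * emeasure mu A \<le> s * emeasure mu B'" if "A \<subseteq> B'" for A
      using that sub by (intro mult_left_mono emeasure_mono) auto
    have BV: "emeasure (nu f p) B \<le> V" unfolding V_def by (rule nu_mono) (use sub cell_subset in auto)
    consider "B \<subseteq> fiber x" | "leaves j \<subseteq> B'"
      | y where "x \<in> core j" "y \<in> B'" "fst (dec y) = j" "snd (dec y) \<in> insert Hub (range Leaf)"
      | "j \<in> J" "B \<inter> leaves j = {x}"
      using B x by (auto simp: admissible_def)
    then show ?thesis
    proof cases
      case 1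
      have "s * emeasure mu {x} \<le> s * emeasure mu B'" using sub by (intro mu_mono) auto
      also note ball
      also have "emeasure (nu f p) B \<le> emeasure (nu f p) (fiber x)"
        by (rule nu_mono[OF 1]) (auto simp: fiber_def)
      finally show ?thesis by blast
    next
      case 2
      have "s * emeasure mu (leaves j) \<le> V" using mu_mono[OF 2] ball BV by (meson order_trans)
      then show ?thesis using V_le by (meson order_trans)
    next
      case 3
      \<comment> \<open>The hub and each leaf weigh at least \<open>w j * leaf_mass j\<close>, half
        the core; an intermediate point could be far lighter.\<close>
      have "w j * leaf_mass j \<le> mass (dec y)"
        using 3 w[of j] leaf_mass_pos[of j] by (auto simp: mass_def mult.commute)
      then have "s * ennreal (w j * leaf_mass j) \<le> s * emeasure mu {y}"
        using sub 3 by (subst emeasure_singleton) (auto intro!: mult_left_mono ennreal_leI)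
      also have "\<dots> \<le> V" using mu_mono[of "{y}"] ball BV 3 by (meson empty_subsetI insert_subset order_trans)
      finally show ?thesis using 3 by blast
    next
      case 4
      have "s * emeasure mu {x} \<le> emeasure (nu f p) (fiber x) \<or> s * emeasure mu (leaves j) \<le> ennreal (2 powr (p - 1) * K) * V"
        unfolding s_def V_def by (rule nu_ge_leaf_ball[OF p t sub(3,4,2) 4(2) K(2)[OF 4(1)] large])
      moreover have "ennreal (2 powr (p - 1) * K) * V \<le> ennreal c * V"
        by (intro mult_right_mono ennreal_leI) (auto simp: c_def)
      ultimately show ?thesis by (meson order_trans)
    qed
  qed
  have half: "s * emeasure mu A \<le> V" if "A \<subseteq> E \<inter> component j" "A \<subseteq> leaves j \<or> A \<subseteq> core j"
    "\<And>x. x \<in> A \<Longrightarrow> s * emeasure mu {x} \<le> emeasure (nu f p) (fiber x)" for A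
    unfolding V_def by (rule emeasure_le_nu_component) (use that E(1) in auto)
  have split: "emeasure mu (A \<inter> component j) = emeasure mu (A \<inter> leaves j) + emeasure mu (A \<inter> core j)" for A
  proof -
    have "A \<inter> component j = (A \<inter> leaves j) \<union> (A \<inter> core j)" unfolding component_eq by blast
    moreover have "A \<inter> cell j U \<in> sets mu" for U using cell_subset[of j U] by auto
    moreover have "(A \<inter> leaves j) \<inter> (A \<inter> core j) = {}" using leaves_Int_core[of j] by blast
    ultimately show ?thesis by (simp only: plus_emeasure)
  qed
  show ?thesis
  proof (cases "s * emeasure mu (leaves j) \<le> ennreal c * V")
    case True
    have "emeasure mu (E \<inter> component j) \<le> emeasure mu (leaves j) + emeasure mu (core j)"
      unfolding split using cell_subset by (intro add_mono emeasure_mono) auto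
    \<comment> \<open>The core weighs at most twice as much as the leaves, since
      \<open>w j \<le> 1 \<le> N j\<close>.\<close>
    also have "\<dots> \<le> ennreal 3 * emeasure mu (leaves j)"
    proof -
      have "w j \<le> N j" using w[of j] N[of j] by linarith
      then have "N j * leaf_mass j + 2 * w j * leaf_mass j \<le> 3 * (N j * leaf_mass j)"
        using leaf_mass_pos[of j] by (simp add: algebra_simps)
      then show ?thesis using leaf_mass_pos[of j] w[of j]
        by (simp add: emeasure_core emeasure_leaves ennreal_mult[symmetric] ennreal_plus[symmetric]
            del: ennreal_plus ennreal_numeral)
    qed
    finally have "s * emeasure mu (E \<inter> component j) \<le> s * (ennreal 3 * emeasure mu (leaves j))"
      by (rule mult_left_mono) simp
    also have "\<dots> = ennreal 3 * (s * emeasure mu (leaves j))" by (simp only: mult.left_commute)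
    also have "\<dots> \<le> ennreal 3 * (ennreal c * V)" using True by (rule mult_left_mono) simp
    also have "\<dots> = ennreal (3 * c) * V" using c by (simp add: ennreal_mult mult.assoc)
    finally show ?thesis by (simp only: s_def c_def V_def)
  next
    case False
    have leaf: "s * emeasure mu (E \<inter> leaves j) \<le> V"
      by (rule half) (use cases False in \<open>auto simp: cell_def\<close>)
    have core: "s * emeasure mu (E \<inter> core j) \<le> 2 * V"
    proof (cases "s * ennreal (w j * leaf_mass j) \<le> V")
      case True
      have "s * emeasure mu (E \<inter> core j) \<le> s * emeasure mu (core j)"
        using cell_subset by (intro mult_left_mono emeasure_mono) auto
      also have "\<dots> = 2 * (s * ennreal (w j * leaf_mass j))"
        using w[of j] leaf_mass_pos[of j] by (simp add: emeasure_core ennreal_mult mult_ac)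
      also have "\<dots> \<le> 2 * V" using True by (rule mult_left_mono) simp
      finally show ?thesis .
    next
      case False2: False
      have "s * emeasure mu (E \<inter> core j) \<le> V"
        by (rule half) (use cases False False2 in \<open>auto simp: cell_def\<close>)
      also have "V \<le> 2 * V" using mult_right_mono[of 1 2 V] by simp
      finally show ?thesis .
    qed
    have "s * emeasure mu (E \<inter> component j) \<le> V + 2 * V"
      unfolding split distrib_left by (rule add_mono[OF leaf core])
    also have "\<dots> = 3 * V" using distrib_right[of 1 2 V] by simp
    also have "\<dots> \<le> ennreal (3 * c) * V" by (rule cV) simp
    finally show ?thesis by (simp only: s_def c_def V_def)
  qed
qed

text \<open>If some subset of \<open>X\<close> has integral at least \<open>t\<close> times the
  total mass, a single estimate on the whole space suffices. Otherwise every witness has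
  \<open>B'\<close> different from \<open>X\<close>, so its \<open>B\<close> stays in the component
  of its point, and the component estimates are added.\<close>

lemma weak_type_of_admissible:
  assumes p: "1 \<le> p" and K: "\<And>j. j \<in> J \<Longrightarrow> real (N j) * w j powr (p - 1) \<le> K"
    and T: "\<And>f t x. x \<in> X \<Longrightarrow> 0 < t \<Longrightarrow> ennreal t < T f x \<Longrightarrow>
      \<exists>B B'. admissible J x B B' \<and> ennreal t * emeasure mu B' \<le> (\<integral>\<^sup>+y\<in>B. ennreal \<bar>f y\<bar> \<partial>mu)"
  shows "weak_type X mu T (ereal p)"
proof -
  \<comment> \<open>The given \<open>K\<close> may be negative when \<open>J\<close> is
    empty.\<close>
  define K' where "K' = max K 0"
  have K': "0 \<le> K'" "real (N j) * w j powr (p - 1) \<le> K'" if "j \<in> J" for j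
    using K[OF that] by (auto simp: K'_def)
  define c where "c = 3 * (1 + 2 powr (p - 1) * K')"
  have c: "1 \<le> c" by (simp add: c_def K'_def)
  \<comment> \<open>The factor 4 undoes the \<open>t / 4\<close> of the local estimates.\<close>
  define C where "C = 4 * c powr (1 / p)"
  have C_powr: "C powr p = 4 powr p * c" using p c by (simp add: C_def powr_mult powr_powr)
  have main: "ennreal ((t / 4) powr p) * emeasure mu {x\<in>X. ennreal t < T f x} \<le> ennreal c * emeasure (nu f p) X"
    if t: "0 < t" for f t
  proof -
    define E where "E = {x\<in>X. ennreal t < T f x}"
    show ?thesis
    proof (cases "\<exists>B\<subseteq>X. ennreal t * emeasure mu X \<le> (\<integral>\<^sup>+y\<in>B. ennreal \<bar>f y\<bar> \<partial>mu)")
      case True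
      then obtain B where B: "B \<subseteq> X" "ennreal t * emeasure mu X \<le> (\<integral>\<^sup>+y\<in>B. ennreal \<bar>f y\<bar> \<partial>mu)" by blast
      have "ennreal ((t / 4) powr p) * emeasure mu E \<le> ennreal ((t / 4) powr p) * emeasure mu X"
        by (intro mult_left_mono emeasure_mono) (auto simp: E_def)
      also have "\<dots> \<le> emeasure (nu f p) B" using nu_ge_ball[OF p t B(1) order_refl B(2)] .
      also have "\<dots> \<le> emeasure (nu f p) X" using B by (intro emeasure_mono) auto
      also have "\<dots> \<le> ennreal c * emeasure (nu f p) X"
        using mult_right_mono[of 1 "ennreal c" "emeasure (nu f p) X"] c by simp
      finally show ?thesis by (simp only: E_def)
    next
      case False
      have E: "\<exists>B B'. admissible J x B B' \<and> B' \<noteq> X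
        \<and> ennreal t * emeasure mu B' \<le> (\<integral>\<^sup>+y\<in>B. ennreal \<bar>f y\<bar> \<partial>mu)" if x: "x \<in> E" for x
      proof -
        obtain B B' where B: "admissible J x B B'" "ennreal t * emeasure mu B' \<le> (\<integral>\<^sup>+y\<in>B. ennreal \<bar>f y\<bar> \<partial>mu)"
          using T[of x t f] x t by (auto simp: E_def)
        then have "B \<subseteq> X" by (auto simp: admissible_def)
        then have "B' \<noteq> X" using False B by blast
        then show "\<exists>B B'. admissible J x B B' \<and> B' \<noteq> X
          \<and> ennreal t * emeasure mu B' \<le> (\<integral>\<^sup>+y\<in>B. ennreal \<bar>f y\<bar> \<partial>mu)" using B by blast
      qed
      have "E \<subseteq> X" by (simp add: E_def)
      have step: "ennreal ((t / 4) powr p) * emeasure mu (E \<inter> component j) \<le> ennreal c * emeasure (nu f p) (component j)" for j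
        unfolding c_def using K' by (intro component_estimate[OF p t _ _ \<open>E \<subseteq> X\<close> E]) (auto simp: K'_def)
      have E_Un: "E = (\<Union>j. E \<inter> component j)" using \<open>E \<subseteq> X\<close> Union_component by blast
      have "emeasure mu E = (\<Sum>j. emeasure mu (E \<inter> component j))"
        by (subst E_Un, rule suminf_emeasure[symmetric])
          (use \<open>E \<subseteq> X\<close> in \<open>auto simp: disjoint_family_on_def cell_def\<close>)
      then have "ennreal ((t / 4) powr p) * emeasure mu E = (\<Sum>j. ennreal ((t / 4) powr p) * emeasure mu (E \<inter> component j))"
        by simp
      also have "\<dots> \<le> (\<Sum>j. ennreal c * emeasure (nu f p) (component j))"
        by (intro suminf_le step) auto
      also have "\<dots> = ennreal c * (\<Sum>j. emeasure (nu f p) (component j))" by simp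
      also have "(\<Sum>j. emeasure (nu f p) (component j)) = emeasure (nu f p) X"
        by (subst Union_component[symmetric], rule suminf_emeasure) (use cell_subset disjoint_component in auto)
      finally show ?thesis by (simp only: E_def)
    qed
  qed
  have bound: "ennreal (t powr p) * outer_meas mu {x\<in>X. ennreal t < T f x}
      \<le> ennreal (C powr p) * (\<integral>\<^sup>+x. ennreal (\<bar>f x\<bar> powr p) \<partial>mu)" if t: "0 < t" for f t
  proof -
    have "outer_meas mu {x\<in>X. ennreal t < T f x} \<le> emeasure mu {x\<in>X. ennreal t < T f x}"
      unfolding outer_meas_def by (intro INF_lower) auto
    then have "ennreal (t powr p) * outer_meas mu {x\<in>X. ennreal t < T f x} \<le> ennreal (t powr p) * emeasure mu {x\<in>X. ennreal t < T f x}"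
      by (rule mult_left_mono) simp
    also have "\<dots> = ennreal (4 powr p) * (ennreal ((t / 4) powr p) * emeasure mu {x\<in>X. ennreal t < T f x})"
      using t by (simp add: mult.assoc[symmetric] ennreal_mult[symmetric] powr_mult[symmetric])
    also have "\<dots> \<le> ennreal (4 powr p) * (ennreal c * emeasure (nu f p) X)"
      by (intro mult_left_mono main t) simp
    also have "\<dots> = ennreal (C powr p) * emeasure (nu f p) X"
      using c by (simp add: C_powr ennreal_mult mult.assoc)
    finally show ?thesis by (simp add: emeasure_nu_X)
  qed
  have "0 \<le> C" using c by (simp add: C_def)
  then show ?thesis unfolding weak_type_def using bound by auto
qed

section \<open>Admissibility of balls and sufficiency for finite \<open>p\<close>\<close>

text \<open>Carries \<open>node_ball_cases\<close> over from nodes to points; \<open>J\<close> only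
  has to contain the components where case \<open>single\<close> can occur.\<close>

lemma admissible_ball:
  assumes y: "y \<in> X" and x: "x \<in> X" and xy: "rho y x < s" and \<kappa>: "1 \<le> \<kappa>"
    and J: "\<And>j. \<kappa> < D j \<Longrightarrow> star j \<or> x \<noteq> y \<Longrightarrow> j \<in> J"
  shows "admissible J x (rho.mball y s) (rho.mball y (\<kappa> * s))"
proof -
  have s: "0 < s" using xy rho_nonneg[of y x] by linarith
  then have s\<kappa>: "s \<le> \<kappa> * s" using \<kappa> by simp
  have sub: "x \<in> rho.mball y s" "rho.mball y s \<subseteq> rho.mball y (\<kappa> * s)" "rho.mball y (\<kappa> * s) \<subseteq> X"
    using x y xy s\<kappa> by (auto simp: mball_eq)
  show ?thesis
  proof (cases "4 < s")
    \<comment> \<open>No distance exceeds 4 and different components are at distance exactly 4, so a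
      ball of radius above 4 is the whole space and any other ball stays inside one
      component.\<close>
    case True
    then have "rho y z < \<kappa> * s" for z using rho_le_4[of y z] s\<kappa> by linarith
    then have "rho.mball y (\<kappa> * s) = X" using y by (simp add: mball_eq)
    then show ?thesis using sub by (simp add: admissible_def)
  next
    case False
    define j where "j = fst (dec y)"
    have B: "fst (dec z) = j \<and> node_dist (star j) (D j) (snd (dec y)) (snd (dec z)) < s" if "z \<in> rho.mball y s" for z
      using that False by (auto simp: mball_eq y rho_def j_def split: if_splits)
    have xj: "fst (dec x) = j" using B sub by blast
    have B': "z \<in> rho.mball y (\<kappa> * s)"
      if "z \<in> X" "fst (dec z) = j" "node_dist (star j) (D j) (snd (dec y)) (snd (dec z)) < \<kappa> * s" for z
      using that by (auto simp: mball_eq y rho_def j_def)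
    have comp: "rho.mball y s \<subseteq> component j" using B by (auto simp: cell_def)
    from D(1)[of j] \<kappa> s B[OF sub(1), THEN conjunct2] show ?thesis
    proof (cases rule: node_ball_cases)
      case fiber
      have "z \<in> fiber x" if z: "z \<in> rho.mball y s" for z
      proof -
        have "snd (dec z) = snd (dec x) \<or> (\<exists>i. snd (dec x) = Leaf i \<and> snd (dec z) = Mid i)"
          using fiber B[OF z] by blast
        moreover have "fst (dec z) = fst (dec x)" "z \<in> X" using B[OF z] z xj by auto
        ultimately show ?thesis by (auto simp: fiber_def prod_eq_iff)
      qed
      then have "rho.mball y s \<subseteq> fiber x" by blast
      then show ?thesis using sub comp xj by (simp add: admissible_def)
    next
      case leaves
      then have "leaves j \<subseteq> rho.mball y (\<kappa> * s)" using B' by (auto simp: cell_def)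
      then show ?thesis using sub comp xj by (simp add: admissible_def)
    next
      case core
      obtain h where h: "h \<in> X" "dec h = (j, Hub)" using dec_surj[of Hub j] by (auto simp: nodes_def)
      have "\<exists>z\<in>rho.mball y (\<kappa> * s). fst (dec z) = j \<and> snd (dec z) \<in> insert Hub (range Leaf)"
      \<comment> \<open>A leaf as centre is itself the heavy node; otherwise the hub is.\<close>
      proof (cases "\<exists>i. snd (dec y) = Leaf i")
        case True
        then have "fst (dec y) = j \<and> snd (dec y) \<in> insert Hub (range Leaf)" by (auto simp: j_def)
        moreover have "y \<in> rho.mball y (\<kappa> * s)" using y s s\<kappa> by simp
        ultimately show ?thesis by blast
      next
        case False
        then have "h \<in> rho.mball y (\<kappa> * s)" using core h by (intro B') auto
        then show ?thesis using h by force
      qed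
      moreover have "x \<in> core j" using core x xj by (auto simp: cell_def)
      ultimately show ?thesis using sub comp xj by (simp add: admissible_def)
    next
      case (single i)
      have "x \<noteq> y" if "snd (dec y) \<noteq> snd (dec x)" using that by auto
      then have "j \<in> J" using single J by blast
      moreover have "z = x" if "z \<in> rho.mball y s" "z \<in> leaves j" for z
      proof -
        have "snd (dec z) = snd (dec x)" using single B[OF that(1)] that(2) by (auto simp: cell_def)
        moreover have "z \<in> X" "fst (dec z) = fst (dec x)" using that xj by (auto simp: cell_def)
        ultimately show ?thesis using dec_eq_iff[of z x] x by (simp add: prod_eq_iff)
      qed
      then have "rho.mball y s \<inter> leaves j = {x}" using single x xj sub by (auto simp: cell_def)
      ultimately show ?thesis using sub comp xj by (simp add: admissible_def)
    qed
  qed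
qed

lemma mball_emeasure:
  assumes "y \<in> X" "0 < s"
  shows "0 < emeasure mu (rho.mball y s)" "emeasure mu (rho.mball y s) < \<infinity>"
  using mms_rho assms unfolding mms_def by auto

text \<open>The centre is \<open>x\<close> itself, which rules out the alternative
  \<open>x \<noteq> y\<close> in \<open>admissible_ball\<close>; only stars remain in
  \<open>J\<close>.\<close>

lemma weak_type_cmax:
  assumes "1 \<le> p" "1 \<le> \<kappa>" "\<And>j. star j \<Longrightarrow> \<kappa> < D j \<Longrightarrow> real (N j) * w j powr (p - 1) \<le> K"
  shows "weak_type X mu (cmax X rho mu \<kappa>) (ereal p)"
proof (rule weak_type_of_admissible[where J = "{j. star j \<and> \<kappa> < D j}" and K = K])
  fix f :: "'a \<Rightarrow> real" and t :: real and x
  assume x: "x \<in> X" and "0 < t" "ennreal t < cmax X rho mu \<kappa> f x"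
  then obtain s where s: "0 < s" "ennreal t < (\<integral>\<^sup>+ y\<in>rho.mball x s. ennreal \<bar>f y\<bar> \<partial>mu) / emeasure mu (rho.mball x (\<kappa> * s))"
    by (auto simp: cmax_def less_SUP_iff)
  have "admissible {j. star j \<and> \<kappa> < D j} x (rho.mball x s) (rho.mball x (\<kappa> * s))"
    by (rule admissible_ball) (use x s assms rho_self in auto)
  moreover have "ennreal t * emeasure mu (rho.mball x (\<kappa> * s)) \<le> (\<integral>\<^sup>+ y\<in>rho.mball x s. ennreal \<bar>f y\<bar> \<partial>mu)"
    by (rule mult_le_of_less_divide[OF s(2)]) (use mball_emeasure[OF x, of "\<kappa> * s"] s assms in auto)
  ultimately show "\<exists>B B'. admissible {j. star j \<and> \<kappa> < D j} x B B' \<and>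
      ennreal t * emeasure mu B' \<le> (\<integral>\<^sup>+y\<in>B. ennreal \<bar>f y\<bar> \<partial>mu)" by blast
qed (use assms in auto)

lemma weak_type_ncmax:
  assumes "1 \<le> p" "1 \<le> \<kappa>" "\<And>j. \<kappa> < D j \<Longrightarrow> real (N j) * w j powr (p - 1) \<le> K"
  shows "weak_type X mu (ncmax X rho mu \<kappa>) (ereal p)"
proof (rule weak_type_of_admissible[where J = "{j. \<kappa> < D j}" and K = K])
  fix f :: "'a \<Rightarrow> real" and t :: real and x
  assume x: "x \<in> X" and "0 < t" "ennreal t < ncmax X rho mu \<kappa> f x"
  then obtain y s where s: "y \<in> X" "0 < s" "x \<in> rho.mball y s"
      "ennreal t < (\<integral>\<^sup>+ z\<in>rho.mball y s. ennreal \<bar>f z\<bar> \<partial>mu) / emeasure mu (rho.mball y (\<kappa> * s))"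
    by (auto simp: ncmax_def less_SUP_iff)
  have "admissible {j. \<kappa> < D j} x (rho.mball y s) (rho.mball y (\<kappa> * s))"
    by (rule admissible_ball) (use x s assms in auto)
  moreover have "ennreal t * emeasure mu (rho.mball y (\<kappa> * s)) \<le> (\<integral>\<^sup>+ z\<in>rho.mball y s. ennreal \<bar>f z\<bar> \<partial>mu)"
    by (rule mult_le_of_less_divide[OF s(4)]) (use mball_emeasure[OF s(1), of "\<kappa> * s"] s assms in auto)
  ultimately show "\<exists>B B'. admissible {j. \<kappa> < D j} x B B' \<and>
      ennreal t * emeasure mu B' \<le> (\<integral>\<^sup>+y\<in>B. ennreal \<bar>f y\<bar> \<partial>mu)" by blast
qed (use assms in auto)

section \<open>The endpoint \<open>p = \<infinity>\<close>\<close>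

lemma ball_average_le_esssup:
  assumes "y \<in> X" "0 < s" "1 \<le> \<kappa>"
  shows "(\<integral>\<^sup>+z\<in>rho.mball y s. ennreal \<bar>f z\<bar> \<partial>mu) / emeasure mu (rho.mball y (\<kappa> * s))
    \<le> esssup mu (\<lambda>x. ennreal \<bar>f x\<bar>)"
proof -
  let ?S = "esssup mu (\<lambda>x. ennreal \<bar>f x\<bar>)"
  have "AE x in mu. ennreal \<bar>f x\<bar> \<le> ?S" by (rule esssup_AE)
  then have "(\<integral>\<^sup>+z\<in>rho.mball y s. ennreal \<bar>f z\<bar> \<partial>mu) \<le> (\<integral>\<^sup>+z\<in>rho.mball y s. ?S \<partial>mu)"
    by (intro nn_integral_mono_AE) (auto split: split_indicator)
  also have "\<dots> = ?S * emeasure mu (rho.mball y s)"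
    by (rule nn_integral_cmult_indicator) (auto simp: mball_eq assms)
  also have "\<dots> \<le> ?S * emeasure mu (rho.mball y (\<kappa> * s))"
    using assms rho.mball_subset_concentric[of s "\<kappa> * s" y] by (intro mult_left_mono emeasure_mono) (auto simp: mball_eq)
  finally show ?thesis
    using assms mball_emeasure[of y "\<kappa> * s"] by (intro divide_le_posI_ennreal) (auto simp: mult.commute)
qed

lemma weak_type_infinity:
  assumes "\<And>f x. x \<in> X \<Longrightarrow> T f x \<le> esssup mu (\<lambda>x. ennreal \<bar>f x\<bar>)"
  shows "weak_type X mu T \<infinity>"
proof -
  have "{x\<in>X. ennreal 1 * esssup mu (\<lambda>x. ennreal \<bar>f x\<bar>) < T f x} = {}" for f
    using assms by (auto simp: not_less)
  moreover have "outer_meas mu {} = 0"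
    unfolding outer_meas_def by (rule antisym, rule INF_lower2[of "{}"]) auto
  ultimately show ?thesis unfolding weak_type_def
    by (simp only: if_True simp_thms) (metis zero_le_one)
qed

lemma weak_type_cmax_infinity: "1 \<le> \<kappa> \<Longrightarrow> weak_type X mu (cmax X rho mu \<kappa>) \<infinity>"
  by (rule weak_type_infinity) (auto simp: cmax_def intro!: SUP_least ball_average_le_esssup)

lemma weak_type_ncmax_infinity: "1 \<le> \<kappa> \<Longrightarrow> weak_type X mu (ncmax X rho mu \<kappa>) \<infinity>"
  by (rule weak_type_infinity) (auto simp: ncmax_def intro!: SUP_least ball_average_le_esssup simp del: rho.in_mball)

subsection \<open>Lower bounds\<close>

text \<open>The test function is the indicator of the hub. At every leaf the given sets yield an
  average of at least \<open>w j / 3\<close>, while the integral of the \<open>p\<close>-th power is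
  \<open>w j * leaf_mass j\<close>. All \<open>N j\<close> leaves then lie in one level set, and
  cancelling \<open>w j\<close> leaves the exponent \<open>p - 1\<close>.\<close>

lemma weak_type_lower_bound:
  assumes wt: "weak_type X mu T (ereal p)" and p: "1 \<le> p"
    and low: "\<And>j x. j \<in> J \<Longrightarrow> x \<in> leaves j \<Longrightarrow> \<exists>B B'. (\<forall>h\<in>X. dec h = (j, Hub) \<longrightarrow> h \<in> B) \<and> B \<subseteq> X
      \<and> x \<in> B' \<and> B' \<subseteq> insert x (core j) \<and> (\<forall>f. (\<integral>\<^sup>+y\<in>B. ennreal \<bar>f y\<bar> \<partial>mu) / emeasure mu B' \<le> T f x)"
  shows "\<exists>K. \<forall>j\<in>J. real (N j) * w j powr (p - 1) \<le> K"
proof -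
  obtain C :: real where C: "0 \<le> C" "\<And>f t. (\<integral>\<^sup>+x. ennreal (\<bar>f x\<bar> powr p) \<partial>mu) < \<infinity> \<Longrightarrow> 0 < t \<Longrightarrow>
      ennreal (t powr p) * outer_meas mu {x\<in>X. ennreal t < T f x} \<le> ennreal (C powr p) * (\<integral>\<^sup>+x. ennreal (\<bar>f x\<bar> powr p) \<partial>mu)"
    using wt measurable_mu unfolding weak_type_def by auto
  have "real (N j) * w j powr (p - 1) \<le> 4 powr p * C powr p" if j: "j \<in> J" for j
  proof -
    obtain h where h: "h \<in> X" "dec h = (j, Hub)" using dec_surj[of Hub j] by (auto simp: nodes_def)
    define f :: "'a \<Rightarrow> real" where "f = indicator {h}"
    have mu_h: "emeasure mu {h} = ennreal (w j * leaf_mass j)"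
      using h by (simp add: emeasure_singleton mass_def mult.commute)
    have "(\<integral>\<^sup>+x. ennreal (\<bar>f x\<bar> powr p) \<partial>mu) = (\<integral>\<^sup>+x. indicator {h} x \<partial>mu)"
      by (intro nn_integral_cong) (auto simp: f_def split: split_indicator)
    then have f_p: "(\<integral>\<^sup>+x. ennreal (\<bar>f x\<bar> powr p) \<partial>mu) = ennreal (w j * leaf_mass j)"
      using h mu_h by simp
    \<comment> \<open>A level below \<open>w j / 3\<close>; the 3 bounds \<open>1 + 2 * w j\<close>,
      the weight of a leaf together with the core in units of \<open>leaf_mass j\<close>.\<close>
    define t where "t = w j / 4"
    have t: "0 < t" using w[of j] by (simp add: t_def)
    have leaf: "ennreal t < T f x" if x: "x \<in> leaves j" for x
    proof -
      obtain B B' where B: "h \<in> B" "B \<subseteq> X" "x \<in> B'" "B' \<subseteq> insert x (core j)"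
          and T: "(\<integral>\<^sup>+y\<in>B. ennreal \<bar>f y\<bar> \<partial>mu) / emeasure mu B' \<le> T f x"
        using low[OF j x] h by metis
      have "(\<integral>\<^sup>+y\<in>B. ennreal \<bar>f y\<bar> \<partial>mu) = (\<integral>\<^sup>+y. indicator {h} y \<partial>mu)"
        using B by (intro nn_integral_cong) (auto simp: f_def split: split_indicator)
      then have I: "(\<integral>\<^sup>+y\<in>B. ennreal \<bar>f y\<bar> \<partial>mu) = ennreal (w j * leaf_mass j)" using h mu_h by simp
      have xX: "x \<in> X" using x by (simp add: cell_def)
      have B'X: "B' \<subseteq> X" using B xX cell_subset[of j "- range Leaf"] by blast
      have "emeasure mu B' \<le> emeasure mu ({x} \<union> core j)"
        using B xX cell_subset[of j "- range Leaf"] by (intro emeasure_mono) auto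
      also have "\<dots> \<le> emeasure mu {x} + emeasure mu (core j)" using xX cell_subset by (intro emeasure_subadditive) auto
      also have "\<dots> = ennreal (leaf_mass j + 2 * w j * leaf_mass j)"
        using leaf_mass_pos[of j] w[of j] by (simp add: emeasure_leaf[OF x] emeasure_core)
      also have "\<dots> \<le> ennreal (3 * leaf_mass j)"
        using leaf_mass_pos[of j] w[of j] by (intro ennreal_leI) (simp add: algebra_simps)
      finally have B'_le: "emeasure mu B' \<le> ennreal (3 * leaf_mass j)" .
      have B'_pos: "0 < emeasure mu B'" using B B'X by (intro emeasure_pos[of _ x])
      define m where "m = measure mu B'"
      have m: "emeasure mu B' = ennreal m" by (simp add: m_def emeasure_eq_measure)
      have m_bounds: "0 < m" "m \<le> 3 * leaf_mass j"
        using B'_pos B'_le leaf_mass_pos[of j] by (auto simp: m ennreal_le_iff)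
      have "t < w j * leaf_mass j / (3 * leaf_mass j)" using leaf_mass_pos[of j] w[of j] by (simp add: t_def)
      also have "\<dots> \<le> w j * leaf_mass j / m"
        using m_bounds leaf_mass_pos[of j] w[of j] by (intro divide_left_mono) auto
      finally have "ennreal t < ennreal (w j * leaf_mass j / m)" using t by (intro ennreal_lessI) auto
      also have "\<dots> = ennreal (w j * leaf_mass j) / emeasure mu B'"
        unfolding m using m_bounds leaf_mass_pos[of j] w[of j] by (intro divide_ennreal[symmetric]) auto
      also have "\<dots> \<le> T f x" using T by (simp only: I)
      finally show ?thesis .
    qed
    have "emeasure mu (leaves j) \<le> outer_meas mu {x\<in>X. ennreal t < T f x}"
      unfolding outer_meas_def using leaf cell_subset[of j "range Leaf"] by (intro INF_greatest emeasure_mono) (auto simp: subset_iff)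
    then have "ennreal (t powr p) * emeasure mu (leaves j) \<le> ennreal (t powr p) * outer_meas mu {x\<in>X. ennreal t < T f x}"
      by (rule mult_left_mono) simp
    also have "\<dots> \<le> ennreal (C powr p) * ennreal (w j * leaf_mass j)"
      using C(2)[of f t] t by (simp add: f_p)
    finally have "ennreal (t powr p * (N j * leaf_mass j)) \<le> ennreal (C powr p * (w j * leaf_mass j))"
      using leaf_mass_pos[of j] w[of j] by (simp add: emeasure_leaves ennreal_mult[symmetric])
    then have "t powr p * (N j * leaf_mass j) \<le> C powr p * (w j * leaf_mass j)"
      using leaf_mass_pos[of j] w[of j] by (subst (asm) ennreal_le_iff) auto
    then have "(t powr p * N j) * leaf_mass j \<le> (C powr p * w j) * leaf_mass j" by (simp add: mult_ac)
    then have "t powr p * N j \<le> C powr p * w j" using leaf_mass_pos[of j] by (simp only: mult_le_cancel_right_pos)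
    moreover have "t powr p = w j powr (p - 1) * w j / 4 powr p"
      using w[of j] by (simp add: t_def powr_divide powr_diff)
    ultimately have "(w j powr (p - 1) * N j) * w j \<le> (4 powr p * C powr p) * w j"
      by (simp add: field_simps)
    then show ?thesis using w[of j] by (simp only: mult_le_cancel_right_pos mult.commute[of "real (N j)"])
  qed
  then show ?thesis by blast
qed

lemma weak_type_cmax_D:
  assumes wt: "weak_type X mu (cmax X rho mu \<kappa>) (ereal p)" and "1 \<le> p" "1 \<le> \<kappa>"
  shows "\<exists>K. \<forall>j. star j \<longrightarrow> \<kappa> < D j \<longrightarrow> real (N j) * w j powr (p - 1) \<le> K"
proof -
  have "\<exists>K. \<forall>j\<in>{j. star j \<and> \<kappa> < D j}. real (N j) * w j powr (p - 1) \<le> K"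
  proof (rule weak_type_lower_bound[OF wt \<open>1 \<le> p\<close>])
    fix j x assume "j \<in> {j. star j \<and> \<kappa> < D j}" and x: "x \<in> leaves j"
    then have j: "star j" "\<kappa> < D j" by auto
    obtain i where i: "x \<in> X" "dec x = (j, Leaf i)" using x by (auto simp: cell_def prod_eq_iff)
    \<comment> \<open>The dilated open ball gets radius exactly \<open>D j\<close> and misses the
      other leaves, while \<open>s > 1\<close> still reaches the hub.\<close>
    define s where "s = D j / \<kappa>"
    have s: "1 < s" "\<kappa> * s = D j" using j assms by (auto simp: s_def)
    have hub: "h \<in> rho.mball x s" if "h \<in> X" "dec h = (j, Hub)" for h
      using that i s j by (simp add: mball_eq rho_def node_dist_def)
    have B': "rho.mball x (\<kappa> * s) \<subseteq> insert x (core j)"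
    proof
      fix z assume "z \<in> rho.mball x (\<kappa> * s)"
      then have z: "z \<in> X" "rho x z < D j" using i s by (auto simp: mball_eq)
      have "fst (dec z) = j" using z i D(2)[of j] by (auto simp: rho_def split: if_splits)
      moreover have "z = x" if "snd (dec z) = Leaf k" for k
      proof -
        have "k = i" using that z i j \<open>fst (dec z) = j\<close> by (auto simp: rho_def node_dist_def split: if_splits)
        then show ?thesis using dec_eq_iff[of z x] z i that \<open>fst (dec z) = j\<close> by (simp add: prod_eq_iff)
      qed
      ultimately show "z \<in> insert x (core j)" using z by (auto simp: cell_def)
    qed
    have le: "(\<integral>\<^sup>+y\<in>rho.mball x s. ennreal \<bar>f y\<bar> \<partial>mu) / emeasure mu (rho.mball x (\<kappa> * s)) \<le> cmax X rho mu \<kappa> f x" for f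
      unfolding cmax_def by (rule SUP_upper) (use s in auto)
    have mem: "x \<in> rho.mball x (\<kappa> * s)" using s i D(1)[of j] by (simp add: rho_self)
    show "\<exists>B B'. (\<forall>h\<in>X. dec h = (j, Hub) \<longrightarrow> h \<in> B) \<and> B \<subseteq> X
      \<and> x \<in> B' \<and> B' \<subseteq> insert x (core j) \<and> (\<forall>f. (\<integral>\<^sup>+y\<in>B. ennreal \<bar>f y\<bar> \<partial>mu) / emeasure mu B' \<le> cmax X rho mu \<kappa> f x)"
      by (intro exI conjI ballI impI allI, erule (1) hub, rule rho.mball_subset_mspace, rule mem, rule B', rule le)
  qed
  then show ?thesis by (simp only: mem_Collect_eq Ball_def) blast
qed

lemma weak_type_ncmax_D:
  assumes wt: "weak_type X mu (ncmax X rho mu \<kappa>) (ereal p)" and "1 \<le> p" "1 \<le> \<kappa>"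
  shows "\<exists>K. \<forall>j. \<not> star j \<longrightarrow> \<kappa> < D j \<longrightarrow> real (N j) * w j powr (p - 1) \<le> K"
proof -
  have "\<exists>K. \<forall>j\<in>{j. \<not> star j \<and> \<kappa> < D j}. real (N j) * w j powr (p - 1) \<le> K"
  proof (rule weak_type_lower_bound[OF wt \<open>1 \<le> p\<close>])
    fix j x assume "j \<in> {j. \<not> star j \<and> \<kappa> < D j}" and x: "x \<in> leaves j"
    then have j: "\<not> star j" "\<kappa> < D j" by auto
    obtain i where i: "x \<in> X" "dec x = (j, Leaf i)" using x by (auto simp: cell_def prod_eq_iff)
    \<comment> \<open>The centre is the intermediate point of the leaf: this leaf and the hub are at
      distance 1 from it, all other leaves at distance \<open>D j\<close>.\<close>
    have "Mid i \<in> nodes (N j)" using dec_mem[OF i(1)] i by (auto simp: nodes_def)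
    then obtain y where y: "y \<in> X" "dec y = (j, Mid i)" using dec_surj by blast
    define s where "s = D j / \<kappa>"
    have s: "1 < s" "\<kappa> * s = D j" using j assms by (auto simp: s_def)
    have hub: "h \<in> rho.mball y s" if "h \<in> X" "dec h = (j, Hub)" for h
      using that y s j by (simp add: mball_eq rho_def node_dist_def)
    have xy: "x \<in> rho.mball y s" using i y s j by (simp add: mball_eq rho_def node_dist_def)
    have B': "rho.mball y (\<kappa> * s) \<subseteq> insert x (core j)"
    proof
      fix z assume "z \<in> rho.mball y (\<kappa> * s)"
      then have z: "z \<in> X" "rho y z < D j" using y s by (auto simp: mball_eq)
      have "fst (dec z) = j" using z y D(2)[of j] by (auto simp: rho_def split: if_splits)
      moreover have "z = x" if "snd (dec z) = Leaf k" for k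
      proof -
        have "k = i" using that z y j \<open>fst (dec z) = j\<close> by (auto simp: rho_def node_dist_def split: if_splits)
        then show ?thesis using dec_eq_iff[of z x] z i that \<open>fst (dec z) = j\<close> by (simp add: prod_eq_iff)
      qed
      ultimately show "z \<in> insert x (core j)" using z by (auto simp: cell_def)
    qed
    have le: "(\<integral>\<^sup>+z\<in>rho.mball y s. ennreal \<bar>f z\<bar> \<partial>mu) / emeasure mu (rho.mball y (\<kappa> * s)) \<le> ncmax X rho mu \<kappa> f x" for f
    proof -
      have "(y, s) \<in> {(y, s). y \<in> X \<and> 0 < s \<and> x \<in> rho.mball y s}" using y s xy by simp
      then show ?thesis unfolding ncmax_def by (rule SUP_upper2) simp
    qed
    have "s \<le> \<kappa> * s" using mult_right_mono[of 1 \<kappa> s] s(1) assms by simp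
    then have mem: "x \<in> rho.mball y (\<kappa> * s)" using xy rho.mball_subset_concentric by blast
    show "\<exists>B B'. (\<forall>h\<in>X. dec h = (j, Hub) \<longrightarrow> h \<in> B) \<and> B \<subseteq> X
      \<and> x \<in> B' \<and> B' \<subseteq> insert x (core j) \<and> (\<forall>f. (\<integral>\<^sup>+y\<in>B. ennreal \<bar>f y\<bar> \<partial>mu) / emeasure mu B' \<le> ncmax X rho mu \<kappa> f x)"
      by (intro exI conjI ballI impI allI, erule (1) hub, rule rho.mball_subset_mspace, rule mem, rule B', rule le)
  qed
  then show ?thesis by (simp only: mem_Collect_eq Ball_def) blast
qed

end

section \<open>Assembling stars and forks into one space\<close>

theorem theorem3p3p1:
  fixes hc h :: "real \<Rightarrow> ereal"
  assumes hc_range: "\<forall>\<kappa>\<in>{1..2}. 1 \<le> hc \<kappa>"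
    and h_range: "\<forall>\<kappa>\<in>{1..3}. 1 \<le> h \<kappa>"
    and hc_mono: "\<forall>a\<in>{1..2}. \<forall>b\<in>{1..2}. a \<le> b \<longrightarrow> hc b \<le> hc a"
    and h_mono: "\<forall>a\<in>{1..3}. \<forall>b\<in>{1..3}. a \<le> b \<longrightarrow> h b \<le> h a"
    and h_ge: "\<forall>\<kappa>\<in>{1..2}. hc \<kappa> \<le> h \<kappa>"
    and hc2: "hc 2 = 1" and h3: "h 3 = 1"
  shows "\<exists>(X::real set) \<rho> \<mu>. mms X \<rho> \<mu> \<and>
     (\<forall>\<kappa>\<in>{1..<2}. \<forall>p::ereal. 1 \<le> p \<longrightarrow>
        (weak_type X \<mu> (cmax X \<rho> \<mu> \<kappa>) p \<longleftrightarrow> p > hc \<kappa> \<or> p = \<infinity>)) \<and>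
     (\<forall>\<kappa>\<in>{1..<3}. \<forall>p::ereal. 1 \<le> p \<longrightarrow>
        (weak_type X \<mu> (ncmax X \<rho> \<mu> \<kappa>) p \<longleftrightarrow> p > h \<kappa> \<or> p = \<infinity>))"
proof -
  have mono_c: "hc y \<le> hc x" if "1 \<le> x" "x \<le> y" "y \<le> 2" for x y
    using hc_mono that by auto
  obtain Dc wc :: "nat \<Rightarrow> real" and Nc :: "nat \<Rightarrow> nat" where
    c_range: "\<forall>i. 1 \<le> Dc i \<and> Dc i \<le> 2 \<and> 1 \<le> Nc i \<and> 0 < wc i \<and> wc i \<le> 1" and
    c_iff: "\<forall>\<kappa>\<in>{1..<2}. \<forall>p\<ge>1.
      (\<exists>K. \<forall>i. \<kappa> < Dc i \<longrightarrow> real (Nc i) * wc i powr (p - 1) \<le> K) \<longleftrightarrow> hc \<kappa> < ereal p"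
    using threshold_profile[of 2 hc, OF _ mono_c] one_less_numeral_iff semiring_norm(76) by blast
  have mono_h: "h y \<le> h x" if "1 \<le> x" "x \<le> y" "y \<le> 3" for x y
    using h_mono that by auto
  obtain Dh wh :: "nat \<Rightarrow> real" and Nh :: "nat \<Rightarrow> nat" where
    h_range': "\<forall>i. 1 \<le> Dh i \<and> Dh i \<le> 3 \<and> 1 \<le> Nh i \<and> 0 < wh i \<and> wh i \<le> 1" and
    h_iff: "\<forall>\<kappa>\<in>{1..<3}. \<forall>p\<ge>1.
      (\<exists>K. \<forall>i. \<kappa> < Dh i \<longrightarrow> real (Nh i) * wh i powr (p - 1) \<le> K) \<longleftrightarrow> h \<kappa> < ereal p"
    using threshold_profile[of 3 h, OF _ mono_h] one_less_numeral_iff semiring_norm(77) by blast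
  \<comment> \<open>Even components are stars adapted to \<open>hc\<close>, odd ones are forks
    adapted to \<open>h\<close>.\<close>
  define D where "D j = (if even j then Dc (j div 2) else Dh (j div 2))" for j :: nat
  define N where "N j = (if even j then Nc (j div 2) else Nh (j div 2))" for j :: nat
  define w where "w j = (if even j then wc (j div 2) else wh (j div 2))" for j :: nat
  define P where "P = {(j, u). u \<in> nodes (N j)}"
  \<comment> \<open>The pairs are countable, so the space can be placed inside the reals; the
    inverse of this coding serves as \<open>dec\<close>.\<close>
  define enc :: "nat \<times> node \<Rightarrow> real" where "enc q = real (to_nat q)" for q
  have "inj_on enc P" by (auto simp: inj_on_def enc_def)
  then have bij: "bij_betw (the_inv_into P enc) (enc ` P) P"
    by (intro bij_betw_the_inv_into inj_on_imp_bij_betw)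
  interpret components "enc ` P" "the_inv_into P enc" even D w N
  proof
    show "bij_betw (the_inv_into P enc) (enc ` P) {(j, u). u \<in> nodes (N j)}"
      using bij by (simp only: P_def)
    fix j
    show "1 \<le> D j" "D j \<le> 3" "even j \<Longrightarrow> D j \<le> 2" "1 \<le> N j" "0 < w j" "w j \<le> 1"
      using c_range[rule_format, of "j div 2"] h_range'[rule_format, of "j div 2"] by (auto simp: D_def N_def w_def)
  qed
  have all_even: "(\<forall>j. even j \<longrightarrow> Q (j div 2)) \<longleftrightarrow> (\<forall>i. Q i)" for Q :: "nat \<Rightarrow> bool"
    by (metis dvd_triv_left nonzero_mult_div_cancel_left zero_neq_numeral)
  have all_odd: "(\<forall>j. odd j \<longrightarrow> Q (j div 2)) \<longleftrightarrow> (\<forall>i. Q i)" for Q :: "nat \<Rightarrow> bool"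
    by (metis even_Suc_div_two even_Suc dvd_triv_left nonzero_mult_div_cancel_left zero_neq_numeral)
  have even_iff: "(\<forall>j. even j \<longrightarrow> \<kappa> < D j \<longrightarrow> real (N j) * w j powr (p - 1) \<le> K)
      \<longleftrightarrow> (\<forall>i. \<kappa> < Dc i \<longrightarrow> real (Nc i) * wc i powr (p - 1) \<le> K)" for \<kappa> p K
    unfolding all_even[symmetric, of "\<lambda>i. \<kappa> < Dc i \<longrightarrow> real (Nc i) * wc i powr (p - 1) \<le> K"]
    by (simp add: D_def N_def w_def)
  have odd_iff: "(\<forall>j. odd j \<longrightarrow> \<kappa> < D j \<longrightarrow> real (N j) * w j powr (p - 1) \<le> K)
      \<longleftrightarrow> (\<forall>i. \<kappa> < Dh i \<longrightarrow> real (Nh i) * wh i powr (p - 1) \<le> K)" for \<kappa> p K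
    unfolding all_odd[symmetric, of "\<lambda>i. \<kappa> < Dh i \<longrightarrow> real (Nh i) * wh i powr (p - 1) \<le> K"]
    by (simp add: D_def N_def w_def)
  have cmax_iff: "weak_type (enc ` P) mu (cmax (enc ` P) rho mu \<kappa>) (ereal p) \<longleftrightarrow> hc \<kappa> < ereal p"
    if \<kappa>: "\<kappa> \<in> {1..<2}" and p: "1 \<le> p" for \<kappa> p
  proof -
    have "weak_type (enc ` P) mu (cmax (enc ` P) rho mu \<kappa>) (ereal p) \<longleftrightarrow>
        (\<exists>K. \<forall>j. even j \<longrightarrow> \<kappa> < D j \<longrightarrow> real (N j) * w j powr (p - 1) \<le> K)"
      using weak_type_cmax_D[of \<kappa> p] weak_type_cmax[of p \<kappa>] \<kappa> p by (metis atLeastLessThan_iff)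
    then show ?thesis using c_iff that by (simp only: even_iff)
  qed
  have ncmax_iff: "weak_type (enc ` P) mu (ncmax (enc ` P) rho mu \<kappa>) (ereal p) \<longleftrightarrow> h \<kappa> < ereal p"
    if \<kappa>: "\<kappa> \<in> {1..<3}" and p: "1 \<le> p" for \<kappa> p
  proof
    assume "weak_type (enc ` P) mu (ncmax (enc ` P) rho mu \<kappa>) (ereal p)"
    from weak_type_ncmax_D[OF this p] have "\<exists>K. \<forall>j. odd j \<longrightarrow> \<kappa> < D j \<longrightarrow> real (N j) * w j powr (p - 1) \<le> K"
      using \<kappa> by simp
    then show "h \<kappa> < ereal p" using h_iff \<kappa> p by (simp only: odd_iff)
  next
    assume less: "h \<kappa> < ereal p"
    then have "\<exists>K. \<forall>i. \<kappa> < Dh i \<longrightarrow> real (Nh i) * wh i powr (p - 1) \<le> K"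
      using h_iff[rule_format, OF \<kappa> p] by (simp only:)
    then obtain K1 where K1: "\<forall>j. odd j \<longrightarrow> \<kappa> < D j \<longrightarrow> real (N j) * w j powr (p - 1) \<le> K1"
      unfolding odd_iff[symmetric] by (elim exE)
    \<comment> \<open>Stars do no harm: for \<open>\<kappa> < 2\<close> they are controlled by
      \<open>hc \<kappa> \<le> h \<kappa> < p\<close>, and for \<open>\<kappa> \<ge> 2\<close> no
      star satisfies \<open>\<kappa> < D j\<close>.\<close>
    obtain K2 where K2: "\<forall>j. even j \<longrightarrow> \<kappa> < D j \<longrightarrow> real (N j) * w j powr (p - 1) \<le> K2"
    proof (cases "\<kappa> < 2")
      case True
      then have "hc \<kappa> \<le> h \<kappa>" using \<kappa> h_ge by auto
      then have "hc \<kappa> < ereal p" using less by (rule le_less_trans)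
      moreover have "\<kappa> \<in> {1..<2}" using True \<kappa> by auto
      ultimately have "\<exists>K. \<forall>i. \<kappa> < Dc i \<longrightarrow> real (Nc i) * wc i powr (p - 1) \<le> K"
        using c_iff[rule_format, OF _ p] by (simp only:)
      then show ?thesis unfolding even_iff[symmetric] by (elim exE) (rule that)
    next
      case False
      have "\<not> \<kappa> < D j" if "even j" for j using False D(3)[OF that] by simp
      then show ?thesis by (intro that[of 0]) blast
    qed
    show "weak_type (enc ` P) mu (ncmax (enc ` P) rho mu \<kappa>) (ereal p)"
    proof (rule weak_type_ncmax[OF p, where K = "max K1 K2"])
      fix j assume "\<kappa> < D j"
      then show "real (N j) * w j powr (p - 1) \<le> max K1 K2"
        using K1[rule_format, of j] K2[rule_format, of j] by (cases "even j") auto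
    qed (use \<kappa> in auto)
  qed
  have cmax_all: "weak_type (enc ` P) mu (cmax (enc ` P) rho mu \<kappa>) p \<longleftrightarrow> hc \<kappa> < p \<or> p = \<infinity>"
    if "\<kappa> \<in> {1..<2}" "1 \<le> p" for \<kappa> p
    using that cmax_iff weak_type_cmax_infinity by (cases p) auto
  have ncmax_all: "weak_type (enc ` P) mu (ncmax (enc ` P) rho mu \<kappa>) p \<longleftrightarrow> h \<kappa> < p \<or> p = \<infinity>"
    if "\<kappa> \<in> {1..<3}" "1 \<le> p" for \<kappa> p
    using that ncmax_iff weak_type_ncmax_infinity by (cases p) auto
  show ?thesis using mms_rho cmax_all ncmax_all by blast
qed

end
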